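(* Let $n,k$ be positive integers and let $G$ be an edge-colored graph on $n$ vertices. Then: (i) If $\delta^c(G)\geq f(k-|C_4(G)|)+4|C_4(G)|+2\sqrt{n}+1$, then $G$ contains $k$ vertex-disjoint properly colored cycles. In particular, if $f(j)=2j-1$ for all $j\geq 1$ (the Bermond–Thomassen Conjecture), then $\delta^c(G)\geq 4k+2\sqrt{n}+1$ suffices. (ii) Suppose $g(k)$ is an integer such that every digraph with minimum out-degree at least $g(k)$ contains $k$ vertex-disjoint directed cycles of pairwise different lengths. Then $\delta^c(G)\geq g(k)+(k+1)(k+n^{1-1/(k+1)})$ suffices to ensure that $G$ contains $k$ vertex-disjoint properly colored cycles of pairwise different lengths.
   Context: All graphs are finite and simple. An edge-colored graph is a graph with a color assigned to each edge (not necessarily proper). The color degree $d^c_G(v)$ is the number of distinct colors on edges incident to $v$, and $\delta^c(G)=\min_v d^c_G(v)$. A subgraph is properly colored if any two adjacent edges receive different colors. $C_4(G)$ denotes a maximum-size set of pairwise vertex-disjoint properly colored 4-cycles in $G$. For a positive integer $j$, $f(j)$ is the smallest integer such that every digraph with minimum out-degree at least $f(j)$ contains $j$ vertex-disjoint directed cycles; for $j\leq 0$ we set $f(j)=0$. *)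

theory Defs
  imports
    Complex_Main
    "HOL-Library.Disjoint_Sets"
    "HOL-Library.Extended_Nat"
    "HOL-Library.Extended_Real"
    "Graph_Theory.Arc_Walk"
begin

section \<open>Edge-colored graphs\<close>

text \<open>Edges are two-element vertex sets. A coloring of the edges is any function
  \<open>c\<close> on vertex sets; only its values on \<open>E\<close> matter.\<close>

definition finite_simple_graph :: "'a set \<Rightarrow> 'a set set \<Rightarrow> bool" where
  "finite_simple_graph V E \<longleftrightarrow> finite V \<and> (\<forall>e\<in>E. e \<subseteq> V \<and> card e = 2)"

definition color_degree :: "'a set set \<Rightarrow> ('a set \<Rightarrow> 'c) \<Rightarrow> 'a \<Rightarrow> nat" where
  "color_degree E c v = card (c ` {e \<in> E. v \<in> e})"

definition min_color_degree :: "'a set \<Rightarrow> 'a set set \<Rightarrow> ('a set \<Rightarrow> 'c) \<Rightarrow> nat" where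
  "min_color_degree V E c = Min (color_degree E c ` V)"

definition properly_colored :: "('a set \<Rightarrow> 'c) \<Rightarrow> 'a set set \<Rightarrow> bool" where
  "properly_colored c F \<longleftrightarrow>
     (\<forall>e\<in>F. \<forall>e'\<in>F. e \<noteq> e' \<and> e \<inter> e' \<noteq> {} \<longrightarrow> c e \<noteq> c e')"

text \<open>A cycle is given by the list of its vertices in cyclic order. Different lists may describe
  the same cycle, but such lists have the same vertices, so at most one of them occurs in a
  vertex-disjoint set of cycles.\<close>

definition cycle_edges :: "'a list \<Rightarrow> 'a set set" where
  "cycle_edges p = {{p ! i, p ! (Suc i mod length p)} | i. i < length p}"

definition pc_cycle :: "'a set set \<Rightarrow> ('a set \<Rightarrow> 'c) \<Rightarrow> 'a list \<Rightarrow> bool" where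
  "pc_cycle E c p \<longleftrightarrow>
     3 \<le> length p \<and> distinct p \<and> cycle_edges p \<subseteq> E \<and> properly_colored c (cycle_edges p)"

definition disjoint_pc_cycles :: "'a set set \<Rightarrow> ('a set \<Rightarrow> 'c) \<Rightarrow> 'a list set \<Rightarrow> bool" where
  "disjoint_pc_cycles E c P \<longleftrightarrow>
     finite P \<and> (\<forall>p\<in>P. pc_cycle E c p) \<and> disjoint_family_on set P"

text \<open>The size of a maximum set of vertex-disjoint properly colored 4-cycles.\<close>

definition c4_number :: "'a set set \<Rightarrow> ('a set \<Rightarrow> 'c) \<Rightarrow> nat" where
  "c4_number E c = Max {card P | P. disjoint_pc_cycles E c P \<and> (\<forall>p\<in>P. length p = 4)}"

section \<open>Disjoint directed cycles in digraphs\<close>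

text \<open>The locale \<^locale>\<open>digraph\<close> is that of finite digraphs without loops and
  parallel arcs; opposite arcs are allowed, and a pair of opposite arcs is a directed cycle of
  length 2. The library admits the null digraph, which is excluded below because its minimum
  out-degree is undefined. Natural numbers as vertices represent every finite digraph up to
  isomorphism.\<close>

type_synonym nat_digraph = "(nat, nat \<times> nat) pre_digraph"

definition min_out_degree :: "('a, 'b) pre_digraph \<Rightarrow> nat" where
  "min_out_degree D = Min (out_degree D ` verts D)"

text \<open>A directed cycle is a list of arcs; its vertices are the tails of its arcs.\<close>

definition disjoint_dicycles :: "('a, 'b) pre_digraph \<Rightarrow> 'b list set \<Rightarrow> bool" where
  "disjoint_dicycles D P \<longleftrightarrow>
     finite P \<and> (\<forall>p\<in>P. pre_digraph.cycle D p) \<and>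
     disjoint_family_on (\<lambda>p. tail D ` set p) P"

definition forces_dicycles :: "int \<Rightarrow> nat \<Rightarrow> bool" where
  "forces_dicycles d j \<longleftrightarrow>
     (\<forall>D :: nat_digraph. digraph D \<and> verts D \<noteq> {} \<and> d \<le> int (min_out_degree D) \<longrightarrow>
        (\<exists>P. disjoint_dicycles D P \<and> card P = j))"

definition forces_dicycles_diff_lengths :: "int \<Rightarrow> nat \<Rightarrow> bool" where
  "forces_dicycles_diff_lengths d j \<longleftrightarrow>
     (\<forall>D :: nat_digraph. digraph D \<and> verts D \<noteq> {} \<and> d \<le> int (min_out_degree D) \<longrightarrow>
        (\<exists>P. disjoint_dicycles D P \<and> card P = j \<and> inj_on length P))"

text \<open>For \<open>j \<ge> 1\<close> this is the least integer \<open>d\<close> such that minimum out-degree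
  at least \<open>d\<close> forces \<open>j\<close> disjoint directed cycles. Only natural numbers need to be
  considered, since an isolated vertex has out-degree 0 and contains no cycle. The infimum is taken
  in \<^typ>\<open>enat\<close> so that the definition does not presuppose that such a \<open>d\<close>
  exists; the infimum of a nonempty set of natural numbers is its least element.\<close>

definition bt_f :: "int \<Rightarrow> enat" where
  "bt_f j = (if j \<le> 0 then 0 else Inf {enat d | d. forces_dicycles (int d) (nat j)})"

end

(* Keep a minimal set of edges that shows the same colours at every vertex. Each remaining colour
   class is then a star forest; orient its edges from leaf to centre. A directed walk in this
   orientation never repeats a colour on consecutive arcs, but a vertex v loses as out-colours the
   colours of which it is a centre, and these may be many. For a set S of vertices, delete the arcs
   into S and add, for every x in S and every colour centred at x, one arc from x back to a leaf of
   that colour. Consecutive arcs still differ in colour, so directed cycles are properly colored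
   cycles, and the loss of out-degree is now less than |S| on S and at most |S| plus the number of
   centred colours off S. If every choice of S loses more than s n^(1-1/s) somewhere, then choosing
   bad vertices greedily gives n^(1-1/s) centres with many chosen leaves each, and the
   Kovari-Sos-Turan count yields a properly colored K_{s,s}, hence properly colored cycles of all
   even lengths from 4 to 2s. Part (i) deletes a maximum packing of 4-cycles and uses s = 2; part
   (ii) uses s = k + 1 and deletes cycles of lengths 4, 6, ... one by one as long as possible. *)

theory Submission
  imports Defs
begin

section \<open>Digraphs with color-changing transitions\<close>

text \<open>In a smallest edge set that still shows every color at every vertex, each edge is the
  only one of its color at one of its ends. The arc leaves that end, so the third property is
  uniqueness of the color at the tail, and each color class consists of stars directed to their
  centers.\<close>

lemma color_star_orientation:
  assumes "finite_simple_graph V E"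
  obtains L :: "('a \<times> 'a) set" where
    "\<And>u v. (u, v) \<in> L \<Longrightarrow> {u, v} \<in> E"
    "\<And>u v. (u, v) \<in> L \<Longrightarrow> (v, u) \<notin> L"
    "\<And>u v w. (u, v) \<in> L \<Longrightarrow> (u, w) \<in> L \<or> (w, u) \<in> L \<Longrightarrow> c {u, v} = c {u, w} \<Longrightarrow> w = v"
    "\<And>v. c ` {e \<in> E. v \<in> e} = (\<lambda>w. c {v, w}) ` {w. (v, w) \<in> L \<or> (w, v) \<in> L}"
proof -
  define Good where "Good F \<longleftrightarrow> F \<subseteq> E \<and> (\<forall>v. c ` {e \<in> F. v \<in> e} = c ` {e \<in> E. v \<in> e})" for F
  have "E \<subseteq> Pow V" and "finite V"
    using assms by (auto simp: finite_simple_graph_def)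
  then have finE: "finite E"
    using finite_subset by blast
  have "Good E" by (simp add: Good_def)
  then obtain F where F: "Good F" and Fmin: "\<And>F'. Good F' \<Longrightarrow> card F \<le> card F'"
    using ex_has_least_nat[of Good E card] by blast
  have FE: "F \<subseteq> E" and Fcol: "\<And>v. c ` {e \<in> F. v \<in> e} = c ` {e \<in> E. v \<in> e}"
    using F by (auto simp: Good_def)
  \<comment> \<open>otherwise deleting \<open>e\<close> would lose no colour at either of its ends\<close>
  have leaf: "\<exists>u\<in>e. \<forall>e'\<in>F. u \<in> e' \<and> c e' = c e \<longrightarrow> e' = e" if e: "e \<in> F" for e
  proof (rule ccontr)
    assume neg: "\<not> ?thesis"
    have "c ` {e' \<in> F - {e}. v \<in> e'} = c ` {e \<in> E. v \<in> e}" for v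
    proof (cases "v \<in> e")
      case True
      with neg obtain e' where "e' \<in> F" "v \<in> e'" "c e' = c e" "e' \<noteq> e" by blast
      then have "c e \<in> c ` {e' \<in> F - {e}. v \<in> e'}"
        by (intro image_eqI[where x = e']) auto
      moreover have "{e \<in> F. v \<in> e} = insert e {e' \<in> F - {e}. v \<in> e'}"
        using e True by auto
      ultimately have "c ` {e' \<in> F - {e}. v \<in> e'} = c ` {e \<in> F. v \<in> e}"
        by (simp add: insert_absorb)
      then show ?thesis using Fcol by simp
    next
      case False
      then have "{e' \<in> F - {e}. v \<in> e'} = {e \<in> F. v \<in> e}" by auto
      then show ?thesis using Fcol by simp
    qed
    then have "Good (F - {e})" using FE by (auto simp: Good_def)
    then have "card F \<le> card (F - {e})" by (rule Fmin)
    moreover have "finite F" using FE finE finite_subset by blast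
    ultimately show False
      using e by (metis card_Diff1_less not_less)
  qed
  then obtain l where l: "\<And>e. e \<in> F \<Longrightarrow> l e \<in> e"
      "\<And>e e'. e \<in> F \<Longrightarrow> e' \<in> F \<Longrightarrow> l e \<in> e' \<Longrightarrow> c e' = c e \<Longrightarrow> e' = e"
    by metis
  have two: "card e = 2" if "e \<in> F" for e
    using that FE assms by (auto simp: finite_simple_graph_def)
  \<comment> \<open>\<open>l\<close> picks a single leaf end even if both ends qualify, so every
    edge of \<open>F\<close> gets exactly one direction.\<close>
  define L where "L = {(u, v). {u, v} \<in> F \<and> l {u, v} = u}"
  have inF: "{u, v} \<in> F" if "(u, v) \<in> L \<or> (v, u) \<in> L" for u v
    using that by (auto simp: L_def insert_commute)
  have neq: "u \<noteq> v" if "{u, v} \<in> F" for u v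
    using two[OF that] by auto
  show thesis
  proof
    show "{u, v} \<in> E" if "(u, v) \<in> L" for u v
      using inF that FE by blast
    show "(v, u) \<notin> L" if "(u, v) \<in> L" for u v
      using that neq by (auto simp: L_def insert_commute)
    show "w = v" if "(u, v) \<in> L" "(u, w) \<in> L \<or> (w, u) \<in> L" "c {u, v} = c {u, w}" for u v w
    proof -
      have "{u, w} = {u, v}"
        using l(2)[of "{u, v}" "{u, w}"] that inF[of u v] inF[of u w] by (auto simp: L_def)
      then show ?thesis by (auto simp: doubleton_eq_iff)
    qed
    show "c ` {e \<in> E. v \<in> e} = (\<lambda>w. c {v, w}) ` {w. (v, w) \<in> L \<or> (w, v) \<in> L}" for v
    proof -
      have "\<exists>w. ((v, w) \<in> L \<or> (w, v) \<in> L) \<and> e = {v, w}" if e: "e \<in> F" "v \<in> e" for e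
      proof -
        obtain w where w: "e = {v, w}"
          using two[OF e(1)] e(2) by (auto simp: card_2_iff)
        then have "l e = v \<or> l e = w" using l(1)[OF e(1)] by auto
        then show ?thesis using w e(1) by (auto simp: L_def insert_commute)
      qed
      then have "{e \<in> F. v \<in> e} = (\<lambda>w. {v, w}) ` {w. (v, w) \<in> L \<or> (w, v) \<in> L}"
        using inF by blast
      then have "c ` {e \<in> F. v \<in> e} = (\<lambda>w. c {v, w}) ` {w. (v, w) \<in> L \<or> (w, v) \<in> L}"
        by (simp add: image_image)
      then show ?thesis using Fcol by simp
    qed
  qed
qed

text \<open>\<open>B x\<close> holds one leaf for each color centered at \<open>x\<close>. A vertex
  in both \<open>B x\<close> and \<open>B x'\<close> is the tail of both arcs, hence the third
  property. \<open>B\<close> is fixed before \<open>S\<close>, so that \<open>S\<close> can later be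
  chosen according to the sizes of the \<open>B v\<close>.\<close>

lemma ex_color_transversal_digraphs:
  fixes c :: "'a set \<Rightarrow> 'c"
  assumes G: "finite_simple_graph V E"
  obtains B :: "'a \<Rightarrow> 'a set" where
    "\<And>x y. y \<in> B x \<Longrightarrow> {x, y} \<in> E"
    "\<And>x y y'. y \<in> B x \<Longrightarrow> y' \<in> B x \<Longrightarrow> y \<noteq> y' \<Longrightarrow> c {x, y} \<noteq> c {x, y'}"
    "\<And>x x' y. y \<in> B x \<Longrightarrow> y \<in> B x' \<Longrightarrow> x \<noteq> x' \<Longrightarrow> c {x, y} \<noteq> c {x', y}"
    "\<And>S. S \<subseteq> V \<Longrightarrow> \<exists>A. (\<forall>(u, v)\<in>A. {u, v} \<in> E) \<and>
      (\<forall>u v w. (u, v) \<in> A \<longrightarrow> (v, w) \<in> A \<longrightarrow> c {u, v} \<noteq> c {v, w}) \<and>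
      (\<forall>v\<in>S. color_degree E c v + 1 \<le> card {w. (v, w) \<in> A} + card S) \<and>
      (\<forall>v\<in>V - S. color_degree E c v \<le> card {w. (v, w) \<in> A} + card (B v) + card S)"
proof (rule color_star_orientation[OF G, of c])
  fix L :: "('a \<times> 'a) set"
  assume LE: "\<And>u v. (u, v) \<in> L \<Longrightarrow> {u, v} \<in> E"
    and asym: "\<And>u v. (u, v) \<in> L \<Longrightarrow> (v, u) \<notin> L"
    and uniq: "\<And>u v w. (u, v) \<in> L \<Longrightarrow> (u, w) \<in> L \<or> (w, u) \<in> L \<Longrightarrow> c {u, v} = c {u, w} \<Longrightarrow> w = v"
    and cols: "\<And>v. c ` {e \<in> E. v \<in> e} = (\<lambda>w. c {v, w}) ` {w. (v, w) \<in> L \<or> (w, v) \<in> L}"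
  have EV: "u \<in> V" "v \<in> V" "u \<noteq> v" if "{u, v} \<in> E" for u v
  proof -
    have "{u, v} \<subseteq> V" "card {u, v} = 2"
      using G that unfolding finite_simple_graph_def by blast+
    then show "u \<in> V" "v \<in> V" "u \<noteq> v" by auto
  qed
  have finV: "finite V" using G by (simp add: finite_simple_graph_def)
  \<comment> \<open>One in-neighbor per color: a subset on which the color map is injective and has
    the same image.\<close>
  have "\<exists>B. B \<subseteq> {w. (w, v) \<in> L} \<and> inj_on (\<lambda>w. c {v, w}) B \<and>
      (\<lambda>w. c {v, w}) ` {w. (w, v) \<in> L} = (\<lambda>w. c {v, w}) ` B" for v
    by (rule iffD1[OF subset_image_inj, OF order_refl])
  then have "\<exists>B. \<forall>v. B v \<subseteq> {w. (w, v) \<in> L} \<and> inj_on (\<lambda>w. c {v, w}) (B v) \<and>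
      (\<lambda>w. c {v, w}) ` {w. (w, v) \<in> L} = (\<lambda>w. c {v, w}) ` B v"
    by (intro choice allI)
  then obtain B where B: "\<forall>v. B v \<subseteq> {w. (w, v) \<in> L} \<and> inj_on (\<lambda>w. c {v, w}) (B v) \<and>
      (\<lambda>w. c {v, w}) ` {w. (w, v) \<in> L} = (\<lambda>w. c {v, w}) ` B v" ..
  have BL: "(w, v) \<in> L" if "w \<in> B v" for v w
    using B that by auto
  have Binj: "inj_on (\<lambda>w. c {v, w}) (B v)"
    and Bcol: "(\<lambda>w. c {v, w}) ` {w. (w, v) \<in> L} = (\<lambda>w. c {v, w}) ` B v" for v
    using B[rule_format, of v] by simp_all
  have "B v \<subseteq> V" for v
    using LE[THEN EV(1)] BL by auto
  then have finB: "finite (B v)" for v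
    using finV finite_subset by blast
  define N where "N v = {w. (v, w) \<in> L}" for v
  have "N v \<subseteq> V" for v
    using LE[THEN EV(2)] by (auto simp: N_def)
  then have finN: "finite (N v)" for v
    using finV finite_subset by blast
  have deg: "color_degree E c v \<le> card (N v) + card (B v)" for v
  proof -
    have "(\<lambda>w. c {v, w}) ` {w. (v, w) \<in> L \<or> (w, v) \<in> L}
        = (\<lambda>w. c {v, w}) ` N v \<union> (\<lambda>w. c {v, w}) ` {w. (w, v) \<in> L}"
      unfolding N_def Collect_disj_eq image_Un ..
    then have "color_degree E c v = card ((\<lambda>w. c {v, w}) ` N v \<union> (\<lambda>w. c {v, w}) ` B v)"
      by (simp only: color_degree_def cols Bcol)
    also have "\<dots> \<le> card ((\<lambda>w. c {v, w}) ` N v) + card ((\<lambda>w. c {v, w}) ` B v)"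
      by (rule card_Un_le)
    also have "\<dots> \<le> card (N v) + card (B v)"
      by (intro add_mono card_image_le finN finB)
    finally show ?thesis .
  qed
  have BE: "{x, y} \<in> E" if "y \<in> B x" for x y
    using LE[OF BL[OF that]] by (simp add: insert_commute)
  show thesis
  proof
    show "{x, y} \<in> E" if "y \<in> B x" for x y
      by (rule BE[OF that])
    show "c {x, y} \<noteq> c {x, y'}" if "y \<in> B x" "y' \<in> B x" "y \<noteq> y'" for x y y'
      using Binj[of x] that by (auto simp: inj_on_def)
    show "c {x, y} \<noteq> c {x', y}" if "y \<in> B x" "y \<in> B x'" "x \<noteq> x'" for x x' y
      using uniq[OF BL[OF that(1)], of x'] BL[OF that(2)] that(3) by (auto simp: insert_commute)
    fix S assume S: "S \<subseteq> V"
    have finS: "finite S" using S finV finite_subset by blast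
    \<comment> \<open>Arcs into \<open>S\<close> are deleted, and each \<open>u\<close> in
      \<open>S\<close> recovers the colors centered at it through arcs to
      \<open>B u\<close>.\<close>
    define A where "A = {(u, v). (u, v) \<in> L \<and> v \<notin> S \<or> u \<in> S \<and> v \<in> B u}"
    have out_in: "{w. (v, w) \<in> A} = (N v - S) \<union> B v" if "v \<in> S" for v
      using that by (auto simp: A_def N_def)
    have out_notin: "{w. (v, w) \<in> A} = N v - S" if "v \<notin> S" for v
      using that by (auto simp: A_def N_def)
    have AE: "\<forall>(u, v)\<in>A. {u, v} \<in> E"
      using LE BE by (auto simp: A_def)
    \<comment> \<open>The middle vertex \<open>v\<close> is the tail in \<open>L\<close> of at least
      one of the two edges, whose color is therefore unique at \<open>v\<close>; equal colors would
      force \<open>w = u\<close>. Then either \<open>L\<close> contains both directions of one edge,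
      or \<open>u\<close> lies in \<open>S\<close> while \<open>w\<close> does not.\<close>
    have turn: "c {u, v} \<noteq> c {v, w}" if uv: "(u, v) \<in> A" and vw: "(v, w) \<in> A" for u v w
    proof
      assume eq: "c {u, v} = c {v, w}"
      then have eq': "c {v, u} = c {v, w}" by (simp add: insert_commute)
      have Avw: "(v, w) \<in> L \<and> w \<notin> S \<or> v \<in> S \<and> (w, v) \<in> L"
        using vw BL by (auto simp: A_def)
      have "(u, v) \<in> L \<and> v \<notin> S \<or> u \<in> S \<and> (v, u) \<in> L"
        using uv BL by (auto simp: A_def)
      then show False
      proof (elim disjE conjE)
        assume "(u, v) \<in> L" "v \<notin> S"
        then show False
          using Avw uniq[of v w u] eq' asym[of u v] by auto
      next
        assume "u \<in> S" "(v, u) \<in> L"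
        then show False
          using Avw uniq[of v u w] eq' asym[of v u] by auto
      qed
    qed
    have in_S: "color_degree E c v + 1 \<le> card {w. (v, w) \<in> A} + card S" if v: "v \<in> S" for v
    proof -
      \<comment> \<open>Since \<open>v\<close> is not its own out-neighbor, it loses at most
        \<open>card S - 1\<close> arcs; this is the \<open>+ 1\<close> in the bound.\<close>
      have "v \<notin> N v" using asym by (auto simp: N_def)
      then have "card (N v) \<le> card ((N v - S) \<union> (S - {v}))"
        by (intro card_mono) (use finS finN[of v] in auto)
      also have "\<dots> \<le> card (N v - S) + card (S - {v})" by (rule card_Un_le)
      finally have "card (N v) \<le> card (N v - S) + card (S - {v})" .
      moreover have "(N v - S) \<inter> B v = {}" using asym BL by (auto simp: N_def)
      then have "card {w. (v, w) \<in> A} = card (N v - S) + card (B v)"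
        using out_in[OF v] finN finB by (simp add: card_Un_disjoint)
      moreover have "card S = card (S - {v}) + 1"
        using card_Suc_Diff1[OF finS v] by simp
      ultimately show ?thesis using deg[of v] by linarith
    qed
    have notin_S: "color_degree E c v \<le> card {w. (v, w) \<in> A} + card (B v) + card S"
      if "v \<in> V - S" for v
    proof -
      have "card (N v) \<le> card ((N v - S) \<union> S)"
        by (intro card_mono) (use finS finN[of v] in auto)
      also have "\<dots> \<le> card (N v - S) + card S" by (rule card_Un_le)
      finally have "card (N v) \<le> card (N v - S) + card S" .
      then show ?thesis using deg[of v] out_notin[of v] that by simp
    qed
    show "\<exists>A. (\<forall>(u, v)\<in>A. {u, v} \<in> E) \<and>
      (\<forall>u v w. (u, v) \<in> A \<longrightarrow> (v, w) \<in> A \<longrightarrow> c {u, v} \<noteq> c {v, w}) \<and>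
      (\<forall>v\<in>S. color_degree E c v + 1 \<le> card {w. (v, w) \<in> A} + card S) \<and>
      (\<forall>v\<in>V - S. color_degree E c v \<le> card {w. (v, w) \<in> A} + card (B v) + card S)"
      by (intro exI[of _ A] conjI AE allI impI ballI) (rule turn in_S notin_S, assumption+)+
  qed
qed

section \<open>Bicliques\<close>

text \<open>Double counting of pairs of a vertex \<open>y\<close> and an \<open>s\<close>-subset of
  \<open>X\<close> all of whose members have \<open>y\<close> in their \<open>B\<close>. If every
  \<open>s\<close>-subset had at most \<open>s - 1\<close> such \<open>y\<close>, there would be too
  few pairs.\<close>

lemma ex_biclique_if_many_incidences:
  fixes B :: "'x \<Rightarrow> 'y set"
  assumes fin: "finite X" "finite W" and sub: "\<And>x. x \<in> X \<Longrightarrow> B x \<subseteq> W"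
    and many: "(s - 1) * (card X choose s) < (\<Sum>y\<in>W. card {x \<in> X. y \<in> B x} choose s)"
  shows "\<exists>X' Y'. X' \<subseteq> X \<and> card X' = s \<and> Y' \<subseteq> W \<and> card Y' = s \<and> (\<forall>x\<in>X'. Y' \<subseteq> B x)"
proof -
  define \<X> where "\<X> = {X'. X' \<subseteq> X \<and> card X' = s}"
  have fX: "finite \<X>" using fin by (simp add: \<X>_def)
  have cX: "card \<X> = card X choose s" using n_subsets[OF fin(1)] by (simp add: \<X>_def)
  have "(\<Sum>y\<in>W. card {x \<in> X. y \<in> B x} choose s) = (\<Sum>y\<in>W. card {X' \<in> \<X>. \<forall>x\<in>X'. y \<in> B x})"
  proof (rule sum.cong[OF refl])
    fix y
    have "{X' \<in> \<X>. \<forall>x\<in>X'. y \<in> B x} = {X'. X' \<subseteq> {x \<in> X. y \<in> B x} \<and> card X' = s}"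
      by (auto simp: \<X>_def)
    then show "(card {x \<in> X. y \<in> B x} choose s) = card {X' \<in> \<X>. \<forall>x\<in>X'. y \<in> B x}"
      using n_subsets[of "{x \<in> X. y \<in> B x}" s] fin by simp
  qed
  also have "\<dots> = (\<Sum>X'\<in>\<X>. card {y \<in> W. \<forall>x\<in>X'. y \<in> B x})"
    using sum_multicount_gen[OF fin(2) fX, of "\<lambda>y X'. \<forall>x\<in>X'. y \<in> B x"] by simp
  finally have eq: "(\<Sum>y\<in>W. card {x \<in> X. y \<in> B x} choose s) = \<dots>" .
  have "\<exists>X'\<in>\<X>. s \<le> card {y \<in> W. \<forall>x\<in>X'. y \<in> B x}"
  proof (rule ccontr)
    assume "\<not> ?thesis"
    then have "card {y \<in> W. \<forall>x\<in>X'. y \<in> B x} \<le> s - 1" if "X' \<in> \<X>" for X'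
      using that by fastforce
    then have "(\<Sum>X'\<in>\<X>. card {y \<in> W. \<forall>x\<in>X'. y \<in> B x}) \<le> card \<X> * (s - 1)"
      using sum_bounded_above[of \<X> "\<lambda>X'. card {y \<in> W. \<forall>x\<in>X'. y \<in> B x}" "s - 1"]
      by simp
    then show False using many eq cX by (simp add: mult.commute)
  qed
  then obtain X' where X': "X' \<in> \<X>" "s \<le> card {y \<in> W. \<forall>x\<in>X'. y \<in> B x}" by blast
  obtain Y' where "Y' \<subseteq> {y \<in> W. \<forall>x\<in>X'. y \<in> B x}" "card Y' = s"
    using obtain_subset_with_card_n[OF X'(2)] by blast
  with X'(1) show ?thesis
    by (intro exI[of _ X'] exI[of _ Y']) (auto simp: \<X>_def)
qed

section \<open>Convexity of binomials and the greedy choice of heavy vertices\<close>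

text \<open>By Pascal's rule the increment of \<open>D choose Suc t\<close> at \<open>D\<close> is
  \<open>D choose t\<close>, which grows with \<open>D\<close>. So the line through \<open>D\<close>
  with this slope stays below the binomial on both sides; integers are used because
  \<open>d - D\<close> may be negative.\<close>

lemma binomial_tangent:
  "int (D choose Suc t) + (int d - int D) * int (D choose t) \<le> int (d choose Suc t)"
proof (cases "D \<le> d")
  case True
  then show ?thesis
  proof (induction d rule: dec_induct)
    case (step d)
    have "D choose t \<le> d choose t" using step by (intro binomial_right_mono) simp
    then show ?case using step.IH by (simp add: algebra_simps)
  qed simp
next
  case False
  then have "d \<le> D" by simp
  then show ?thesis
  proof (induction D rule: dec_induct)
    case (step D)
    have le: "D choose t \<le> Suc D choose t" by (intro binomial_right_mono) simp
    then have "(int D - int d) * int (D choose t) \<le> (int D - int d) * int (Suc D choose t)"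
      using step by (intro mult_left_mono) auto
    then show ?case using step.IH le by (simp add: algebra_simps)
  qed simp
qed

text \<open>Greedy choice: if the set \<open>X\<close> of \<open>T\<close> vertices chosen so far
  does not serve as \<open>S\<close>, some \<open>v\<close> outside it has
  \<open>a v > l - T\<close> and is added. The lower bound is the sum of \<open>l - i\<close> over
  \<open>i < T\<close>.\<close>

lemma ex_small_set_or_heavy_set:
  fixes a :: "'a \<Rightarrow> nat" and l :: real
  assumes "finite V"
  shows "(\<exists>S\<subseteq>V. card S < T \<and> (\<forall>v\<in>V - S. real (a v) + real (card S) \<le> l)) \<or>
    (\<exists>X\<subseteq>V. card X = T \<and> real T * l - real T * (real T - 1) / 2 \<le> (\<Sum>x\<in>X. real (a x)))"
proof (induction T)
  case 0
  then show ?case by (auto intro: exI[of _ "{}"])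
next
  case (Suc T)
  show ?case
  proof (cases "\<exists>S\<subseteq>V. card S < Suc T \<and> (\<forall>v\<in>V - S. real (a v) + real (card S) \<le> l)")
    case False
    then obtain X where X: "X \<subseteq> V" "card X = T"
        "real T * l - real T * (real T - 1) / 2 \<le> (\<Sum>x\<in>X. real (a x))"
      using Suc.IH less_SucI by blast
    with False obtain v where v: "v \<in> V - X" "l < real (a v) + real T"
      by (metis lessI not_le)
    have "finite X" using X(1) assms finite_subset by blast
    with v X have "insert v X \<subseteq> V" "card (insert v X) = Suc T"
        "(\<Sum>x\<in>insert v X. real (a x)) = real (a v) + (\<Sum>x\<in>X. real (a x))"
      by auto
    moreover have "real (Suc T) * l - real (Suc T) * (real (Suc T) - 1) / 2
        \<le> real (a v) + (\<Sum>x\<in>X. real (a x))"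
      using X(3) v(2) by (simp add: field_simps)
    ultimately show ?thesis by metis
  qed simp
qed

text \<open>The right-hand side is a falling factorial whose smallest factor is
  \<open>n + 1 - k\<close>. For \<open>k > n\<close> truncated subtraction makes the left-hand side
  0.\<close>

lemma binomial_fact_ge_pow: "(n + 1 - k) ^ k \<le> (n choose k) * fact k"
proof (induction k)
  case (Suc k)
  have "(n + 1 - Suc k) ^ Suc k \<le> (n - k) * (n + 1 - k) ^ k"
    by (simp add: power_mono)
  also have "\<dots> \<le> (n - k) * ((n choose k) * fact k)"
    using Suc.IH by simp
  also have "\<dots> = (n choose Suc k) * fact (Suc k)"
  proof -
    have "Suc k * (n choose Suc k) = (n - k) * (n choose k)"
      by (metis binomial_absorb_comp binomial_absorption mult.commute)
    then have "(n - k) * ((n choose k) * fact k) = Suc k * (n choose Suc k) * fact k"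
      by (simp only: mult.assoc)
    then show ?thesis by (simp only: fact_Suc of_nat_id mult_ac)
  qed
  finally show ?case .
qed simp

lemma sum_choose_ge_tangent:
  assumes "finite W"
  shows "int (card W) * int (D choose Suc t) +
    (int (\<Sum>y\<in>W. d y) - int (card W) * int D) * int (D choose t) \<le> int (\<Sum>y\<in>W. d y choose Suc t)"
proof -
  have "(\<Sum>y\<in>W. int (D choose Suc t) + (int (d y) - int D) * int (D choose t))
      \<le> (\<Sum>y\<in>W. int (d y choose Suc t))"
    by (intro sum_mono binomial_tangent)
  then show ?thesis
    by (simp add: sum.distrib sum_distrib_right[symmetric] sum_subtractf)
qed

text \<open>From \<open>s = 4\<close> on the power is at least 3, so a further factor
  \<open>4 / 3\<close> adds at least 1. At \<open>s = 3\<close> the power is \<open>64 / 27\<close>,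
  too small to start this induction, and is checked separately.\<close>

lemma four_thirds_pow_ge: "3 \<le> s \<Longrightarrow> real s - 1 \<le> (4 / 3) ^ s"
proof -
  have "real s - 1 \<le> (4 / 3) ^ s" if "4 \<le> s"
    using that by (induction s rule: dec_induct) (auto simp: power_numeral_reduce)
  then show "3 \<le> s \<Longrightarrow> ?thesis"
    by (cases "s = 3") (auto simp: power_numeral_reduce)
qed

text \<open>For \<open>s = 2\<close> there is almost no slack, so the tangent is taken at degree 1 instead of
  the average degree.\<close>

lemma sum_choose_gt_two:
  fixes d :: "'b \<Rightarrow> nat"
  assumes "finite W" and n: "card W = n" and T: "T = nat \<lceil>sqrt (real n)\<rceil>" and "1 \<le> n"
    and sum: "real T * (2 * sqrt (real n)) - real T * (real T - 1) / 2 \<le> real (\<Sum>y\<in>W. d y)"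
  shows "T choose 2 < (\<Sum>y\<in>W. d y choose 2)"
proof -
  define r where "r = sqrt (real n)"
  have r: "r * r = real n" "1 \<le> r" using \<open>1 \<le> n\<close> by (auto simp: r_def)
  have T': "r \<le> real T" "real T < r + 1"
    using T r by (simp_all add: r_def) linarith+
  \<comment> \<open>\<open>real T - r\<close> lies between 0 and 1, so it bounds its own square;
    expanding with \<open>r * r = n\<close> gives the next inequality.\<close>
  have "(real T - r) * (real T - r) \<le> real T - r"
    using T' by (simp add: mult_left_le)
  then have "real T * (real T - 1) < 2 * r * real T - real n"
    using r by (simp add: algebra_simps)
  moreover have "real (T choose 2) = real T * (real T - 1) / 2"
    using choose_two[of T] by (cases T) (auto simp: algebra_simps real_of_nat_div)
  ultimately have "real (T choose 2) < real (\<Sum>y\<in>W. d y) - real n"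
    using sum by (simp add: r_def field_simps)
  moreover have "int (\<Sum>y\<in>W. d y) - int n \<le> int (\<Sum>y\<in>W. d y choose 2)"
    using sum_choose_ge_tangent[OF assms(1), of 1 1 d] n by (simp add: numeral_2_eq_2)
  ultimately show ?thesis by linarith
qed

text \<open>The tangent is taken at the rounded-down average degree \<open>D\<close>. The factor \<open>4/3\<close>
  absorbs both the rounding and \<open>s - 1 \<le> (4/3) ^ s\<close>; it is small enough for \<open>s = 3\<close>.\<close>

lemma sum_choose_gt_ge_three:
  fixes d :: "'b \<Rightarrow> nat"
  defines "r \<equiv> \<lambda>n s :: nat. real n powr (1 - 1 / real s)"
  assumes W: "finite W" and n: "card W = n" and T: "T = nat \<lceil>r n s\<rceil>" and s: "3 \<le> s"
    and less: "real s * r n s < real n"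
    and sum: "real T * (real s * r n s) - real T * (real T - 1) / 2 \<le> real (\<Sum>y\<in>W. d y)"
  shows "(s - 1) * (T choose s) < (\<Sum>y\<in>W. d y choose s)"
proof -
  have "n \<noteq> 0" using less by (cases "n = 0") (auto simp: r_def)
  \<comment> \<open>The two factors satisfy \<open>q * R = n\<close> and \<open>q ^ s = n\<close>.
    The assumption \<open>less\<close> then says \<open>s < q\<close>, and \<open>3 \<le> s\<close>
    gives \<open>R = q ^ (s - 1) \<ge> q ^ 2 \<ge> s * q\<close>.\<close>
  define q where "q = real n powr (1 / real s)"
  define R where "R = r n s"
  have qR: "q * R = real n"
    using \<open>n \<noteq> 0\<close> by (simp add: q_def R_def r_def powr_add[symmetric])
  have "0 < R" "0 < q" using \<open>n \<noteq> 0\<close> by (simp_all add: R_def r_def q_def)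
  have qs: "q ^ s = real n"
    using \<open>n \<noteq> 0\<close> s by (simp add: q_def powr_realpow[symmetric] powr_powr)
  have "real s * R < q * R" using less qR by (simp add: R_def)
  then have sq: "real s < q" using \<open>0 < R\<close> by simp
  have "q * q ^ (s - 1) = q * R"
    using qs qR s by (simp add: power_eq_if)
  then have "R = q ^ (s - 1)" using \<open>0 < q\<close> by simp
  moreover have "q ^ 2 \<le> q ^ (s - 1)" using s sq by (intro power_increasing) auto
  moreover have "real s * q \<le> q ^ 2" using sq \<open>0 < q\<close> by (simp add: power2_eq_square)
  ultimately have Rsq: "real s * q \<le> R" by simp
  have T': "R \<le> real T" "real T < R + 1"
    using T \<open>0 < R\<close> unfolding R_def by linarith+
  define M where "M = (\<Sum>y\<in>W. d y)"
  \<comment> \<open>From \<open>T < R + 1\<close>, the correction \<open>(T - 1) / 2\<close> is at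
    most \<open>R / 2\<close>.\<close>
  have "R * ((real s - 1 / 2) * R) \<le> real T * (real s * R - (real T - 1) / 2)"
    using T' \<open>0 < R\<close> s by (intro mult_mono) (auto simp: algebra_simps)
  also have "\<dots> \<le> real M"
    using sum by (simp add: M_def R_def algebra_simps)
  finally have M: "R * ((real s - 1 / 2) * R) \<le> real M" .
  define D where "D = M div n"
  have "M < n * (D + 1)"
    using \<open>n \<noteq> 0\<close> by (simp add: D_def dividend_less_times_div)
  then have "real M < real n * (real D + 1)"
    by (metis of_nat_1 of_nat_add of_nat_less_iff of_nat_mult)
  then have "R * ((real s - 1 / 2) * R) < R * (q * (real D + 1))"
    using M by (simp add: qR[symmetric] mult_ac)
  then have D: "(real s - 1 / 2) * R < q * (real D + 1)"
    using \<open>0 < R\<close> by simp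
  \<comment> \<open>As \<open>11 / 6 = 1 / 2 + 4 / 3\<close>, the claim is
    \<open>4 / 3 + s * q \<le> (s - 11 / 6) * R\<close>. Replacing \<open>R\<close> by
    \<open>s * q\<close> leaves \<open>4 / 3 \<le> s * (s - 17 / 6) * q\<close>, whose right-hand
    side is at least \<open>3 / 2\<close>.\<close>
  have "4 / 3 * (R + 1) \<le> (real s - 1 / 2) * R - real s * q"
  proof -
    have "1 / 2 * 3 \<le> (real s * (real s - 17 / 6)) * q"
    proof (intro mult_mono)
      have "3 * (1 / 6) \<le> real s * (real s - 17 / 6)"
        using s by (intro mult_mono) auto
      then show "1 / 2 \<le> real s * (real s - 17 / 6)" by simp
      then show "0 \<le> real s * (real s - 17 / 6)" by linarith
    qed (use sq s in auto)
    moreover have "(real s - 11 / 6) * (real s * q) \<le> (real s - 11 / 6) * R"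
      using Rsq s by (intro mult_left_mono) auto
    ultimately show ?thesis by (simp add: field_simps)
  qed
  then have qD: "4 / 3 * real T < q * (real D + 1 - real s)"
    using D T' by (simp add: field_simps)
  moreover have "0 < real T" using T' \<open>0 < R\<close> by linarith
  ultimately have "0 < q * (real D + 1 - real s)" by linarith
  then have "0 < real D + 1 - real s" using \<open>0 < q\<close> by (simp add: zero_less_mult_iff)
  then have sD: "s \<le> D + 1" by linarith
  \<comment> \<open>The factor \<open>fact s\<close> allows binomials to be compared with powers;
    raising \<open>qD\<close> to the power \<open>s\<close> turns \<open>q\<close> into
    \<open>n\<close>.\<close>
  have "(real s - 1) * real ((T choose s) * fact s) \<le> (4 / 3) ^ s * real (T ^ s)"
    using four_thirds_pow_ge[OF s] s
    by (intro mult_mono of_nat_mono binomial_fact_pow) simp_all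
  also have "\<dots> = (4 / 3 * real T) ^ s" by (simp only: power_mult_distrib of_nat_power)
  also have "\<dots> < (q * (real D + 1 - real s)) ^ s"
    using qD s \<open>0 < real T\<close> by (intro power_strict_mono) auto
  also have "\<dots> = real n * real ((D + 1 - s) ^ s)"
  proof -
    have "real (D + 1 - s) = real D + 1 - real s" using sD by simp
    then show ?thesis by (simp only: power_mult_distrib qs of_nat_power)
  qed
  also have "\<dots> \<le> real n * real ((D choose s) * fact s)"
    by (intro mult_left_mono of_nat_mono binomial_fact_ge_pow) simp
  finally have "(real s - 1) * real (T choose s) < real n * real (D choose s)"
    by (simp add: mult.assoc[symmetric])
  then have "real ((s - 1) * (T choose s)) < real (n * (D choose s))"
    using s by (simp add: of_nat_diff)
  then have "(s - 1) * (T choose s) < n * (D choose s)"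
    by (simp only: of_nat_less_iff)
  moreover have "int n * int (D choose s) \<le> int (\<Sum>y\<in>W. d y choose s)"
  proof -
    have "n * D \<le> M" by (simp add: D_def)
    then have "0 \<le> (int M - int n * int D) * int (D choose (s - 1))"
      by (metis diff_ge_0_iff_ge mult_nonneg_nonneg of_nat_0_le_iff of_nat_le_iff of_nat_mult)
    then show ?thesis
      using sum_choose_ge_tangent[OF W, of D "s - 1" d] s n by (simp add: M_def)
  qed
  then have "n * (D choose s) \<le> (\<Sum>y\<in>W. d y choose s)"
    by (metis of_nat_le_iff of_nat_mult)
  ultimately show ?thesis by linarith
qed

section \<open>From walks and bicliques to properly colored cycles\<close>

lemma nth_Suc_mod_eq_iff:
  assumes "distinct p" "i < length p" "j < length p"
  shows "p ! (Suc i mod length p) = p ! (Suc j mod length p) \<longleftrightarrow> i = j"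
proof -
  have "Suc i mod length p = Suc j mod length p \<longleftrightarrow> i = j"
    using assms(2,3) by (auto simp: mod_Suc)
  moreover have "Suc i mod length p < length p" "Suc j mod length p < length p"
    using assms(2) by (auto intro: mod_less_divisor)
  ultimately show ?thesis using assms(1) by (simp add: nth_eq_iff_index_eq)
qed

text \<open>Edges at different positions differ in their first vertices and in their second
  vertices, so they can meet only if they are consecutive. Only the turns need checking.\<close>

lemma pc_cycleI:
  assumes "3 \<le> length p" and dist: "distinct p"
    and edge: "\<And>i. i < length p \<Longrightarrow> {p ! i, p ! (Suc i mod length p)} \<in> E"
    and turn: "\<And>i j. i < length p \<Longrightarrow> j = Suc i mod length p \<Longrightarrow>
      c {p ! i, p ! j} \<noteq> c {p ! j, p ! (Suc j mod length p)}"
  shows "pc_cycle E c p"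
proof -
  have "c {p ! i, p ! (Suc i mod length p)} \<noteq> c {p ! j, p ! (Suc j mod length p)}"
    if i: "i < length p" and j: "j < length p" and "i \<noteq> j"
      and "{p ! i, p ! (Suc i mod length p)} \<inter> {p ! j, p ! (Suc j mod length p)} \<noteq> {}" for i j
  proof -
    have lt: "Suc i mod length p < length p" "Suc j mod length p < length p"
      using i by (auto intro: mod_less_divisor)
    have "p ! i \<noteq> p ! j" "p ! (Suc i mod length p) \<noteq> p ! (Suc j mod length p)"
      using that dist by (auto simp: nth_eq_iff_index_eq nth_Suc_mod_eq_iff)
    then have "p ! i = p ! (Suc j mod length p) \<or> p ! j = p ! (Suc i mod length p)"
      using that by auto
    then have "i = Suc j mod length p \<or> j = Suc i mod length p"
      using i j lt dist by (simp add: nth_eq_iff_index_eq)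
    then show ?thesis using turn[OF i refl] turn[OF j refl] by auto
  qed
  then have "properly_colored c (cycle_edges p)"
    unfolding properly_colored_def cycle_edges_def by blast
  then show ?thesis using assms by (auto simp: pc_cycle_def cycle_edges_def)
qed

text \<open>The cycle alternates between \<open>j\<close> vertices of \<open>X\<close> at even
  positions and \<open>j\<close> of \<open>Y\<close> at odd ones; \<open>cX\<close> and
  \<open>cY\<close> are the color changes at the two kinds of turns.\<close>

lemma pc_even_cycle_in_biclique:
  assumes X: "finite X" "j \<le> card X" and Y: "finite Y" "j \<le> card Y" and "2 \<le> j"
    and neq: "\<And>x y. x \<in> X \<Longrightarrow> y \<in> Y \<Longrightarrow> x \<noteq> y"
    and E: "\<And>x y. x \<in> X \<Longrightarrow> y \<in> Y \<Longrightarrow> {x, y} \<in> E"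
    and cX: "\<And>x y y'. x \<in> X \<Longrightarrow> y \<in> Y \<Longrightarrow> y' \<in> Y \<Longrightarrow> y \<noteq> y' \<Longrightarrow> c {x, y} \<noteq> c {x, y'}"
    and cY: "\<And>x x' y. x \<in> X \<Longrightarrow> x' \<in> X \<Longrightarrow> y \<in> Y \<Longrightarrow> x \<noteq> x' \<Longrightarrow> c {x, y} \<noteq> c {x', y}"
  shows "\<exists>p. pc_cycle E c p \<and> length p = 2 * j"
proof -
  obtain f where f: "f ` {..<j} \<subseteq> X" "inj_on f {..<j}"
    using card_le_inj[of "{..<j}" X] X by auto
  obtain g where g: "g ` {..<j} \<subseteq> Y" "inj_on g {..<j}"
    using card_le_inj[of "{..<j}" Y] Y by auto
  define h where "h i = (if even i then f (i div 2) else g (i div 2))" for i :: nat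
  define p where "p = map h [0..<2 * j]"
  have len: "length p = 2 * j" by (simp add: p_def)
  have nth: "p ! i = h i" if "i < 2 * j" for i using that by (simp add: p_def)
  have hX: "h i \<in> X" if "i < 2 * j" "even i" for i
    using that f(1) by (auto simp: h_def image_subset_iff less_mult_imp_div_less mult.commute)
  have hY: "h i \<in> Y" if "i < 2 * j" "odd i" for i
    using that g(1) by (auto simp: h_def image_subset_iff less_mult_imp_div_less mult.commute)
  have hinj: "h i \<noteq> h i'" if "i < 2 * j" "i' < 2 * j" "i \<noteq> i'" for i i'
  proof (cases "even i = even i'")
    case True
    then have "i div 2 \<noteq> i' div 2" using that(3) by presburger
    moreover have "i div 2 \<in> {..<j}" "i' div 2 \<in> {..<j}" using that by auto
    ultimately show ?thesis
      using True f(2) g(2) by (auto simp: h_def inj_on_def)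
  next
    case False
    then show ?thesis
      using hX[of i] hY[of i] hX[of i'] hY[of i'] neq[of "h i" "h i'"] neq[of "h i'" "h i"] that
      by auto
  qed
  have parity: "even (Suc i mod (2 * j)) = odd i" for i
    by (simp add: dvd_mod_iff)
  have lt: "Suc i mod (2 * j) < 2 * j" for i using \<open>2 \<le> j\<close> by simp
  have "pc_cycle E c p"
  proof (rule pc_cycleI)
    show "3 \<le> length p" using len \<open>2 \<le> j\<close> by simp
    have "inj_on h {0..<2 * j}"
      by (rule inj_onI, rule ccontr) (use hinj in auto)
    then show "distinct p" by (simp add: p_def distinct_map)
    show "{p ! i, p ! (Suc i mod length p)} \<in> E" if "i < length p" for i
    proof (cases "even i")
      case True
      then show ?thesis using that len nth lt hX hY parity E by simp
    next
      case False
      then show ?thesis using that len nth lt hX hY parity E[of "h (Suc i mod (2 * j))" "h i"]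
        by (simp add: insert_commute)
    qed
    fix i k assume i: "i < length p" and k: "k = Suc i mod length p"
    define l where "l = Suc k mod (2 * j)"
    \<comment> \<open>The cycle has length at least 4, so two steps along it do not return to the
      start.\<close>
    have il: "i \<noteq> l" using i k len \<open>2 \<le> j\<close> by (auto simp: l_def mod_Suc split: if_splits)
    have b: "i < 2 * j" "k < 2 * j" "l < 2 * j" using i k len lt by (auto simp: l_def)
    have par: "even k = odd i" "even l = odd k"
      using parity k len by (simp_all add: l_def)
    have "c {h i, h k} \<noteq> c {h k, h l}"
    proof (cases "even k")
      case True
      then show ?thesis
        using cX[of "h k" "h i" "h l"] hX[of k] hY[of i] hY[of l] hinj[of i l] b par il
        by (auto simp: insert_commute)
    next
      case False
      then show ?thesis
        using cY[of "h i" "h l" "h k"] hY[of k] hX[of i] hX[of l] hinj[of i l] b par il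
        by (auto simp: insert_commute)
    qed
    then show "c {p ! i, p ! k} \<noteq> c {p ! k, p ! (Suc k mod length p)}"
      using b nth len by (simp add: l_def)
  qed
  then show ?thesis using len by blast
qed

text \<open>If no small \<open>S\<close> worked, a heavy set of about
  \<open>n powr (1 - 1 / s)\<close> vertices would yield a properly colored biclique and in it a
  cycle of the excluded length. \<open>N\<close> is meant as the order of the graph before a
  deletion, which is why it may exceed \<open>card V\<close>.\<close>

lemma ex_transition_digraph:
  fixes c :: "'a set \<Rightarrow> 'c" and g :: int
  assumes G: "finite_simple_graph V E" and "V \<noteq> {}" and "card V \<le> N" and j: "2 \<le> j" "j \<le> s"
    and no_cycle: "\<And>p. pc_cycle E c p \<Longrightarrow> length p \<noteq> 2 * j"
    and deg: "\<And>v. v \<in> V \<Longrightarrow>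
      real_of_int g + real s * real N powr (1 - 1 / real s) \<le> real (color_degree E c v)"
  obtains A where "\<And>u v. (u, v) \<in> A \<Longrightarrow> {u, v} \<in> E"
    "\<And>u v w. (u, v) \<in> A \<Longrightarrow> (v, w) \<in> A \<Longrightarrow> c {u, v} \<noteq> c {v, w}"
    "\<And>v. v \<in> V \<Longrightarrow> g \<le> int (card {w. (v, w) \<in> A})"
proof (rule ex_color_transversal_digraphs[OF G, of c])
  fix B :: "'a \<Rightarrow> 'a set"
  assume BE: "\<And>x y. y \<in> B x \<Longrightarrow> {x, y} \<in> E"
    and Bx: "\<And>x y y'. y \<in> B x \<Longrightarrow> y' \<in> B x \<Longrightarrow> y \<noteq> y' \<Longrightarrow> c {x, y} \<noteq> c {x, y'}"
    and By: "\<And>x x' y. y \<in> B x \<Longrightarrow> y \<in> B x' \<Longrightarrow> x \<noteq> x' \<Longrightarrow> c {x, y} \<noteq> c {x', y}"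
    and BA: "\<And>S. S \<subseteq> V \<Longrightarrow> \<exists>A. (\<forall>(u, v)\<in>A. {u, v} \<in> E) \<and>
      (\<forall>u v w. (u, v) \<in> A \<longrightarrow> (v, w) \<in> A \<longrightarrow> c {u, v} \<noteq> c {v, w}) \<and>
      (\<forall>v\<in>S. color_degree E c v + 1 \<le> card {w. (v, w) \<in> A} + card S) \<and>
      (\<forall>v\<in>V - S. color_degree E c v \<le> card {w. (v, w) \<in> A} + card (B v) + card S)"
  have finV: "finite V" using G by (simp add: finite_simple_graph_def)
  have BV: "B x \<subseteq> V" for x
  proof
    fix y assume "y \<in> B x"
    then have "{x, y} \<in> E" by (rule BE)
    then have "{x, y} \<subseteq> V" using G unfolding finite_simple_graph_def by blast
    then show "y \<in> V" by simp
  qed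
  have Bneq: "x \<noteq> y" if "y \<in> B x" for x y
  proof -
    have "card {x, y} = 2" using BE[OF that] G by (simp add: finite_simple_graph_def)
    then show ?thesis by auto
  qed
  define n where "n = card V"
  have n1: "1 \<le> n" using \<open>V \<noteq> {}\<close> finV by (simp add: n_def Suc_le_eq card_gt_0_iff)
  define r where "r = real n powr (1 - 1 / real s)"
  define l where "l = real s * r"
  have rN: "r \<le> real N powr (1 - 1 / real s)"
    unfolding r_def using \<open>card V \<le> N\<close> j by (intro powr_mono2) (auto simp: n_def)
  have "r \<ge> 0" by (simp add: r_def)
  then have "r \<le> l" using j mult_right_mono[of 1 "real s" r] by (simp add: l_def)
  have "\<exists>S\<subseteq>V. real (card S) \<le> l + 1 \<and> (\<forall>v\<in>V - S. real (card (B v)) + real (card S) \<le> l)"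
  proof (cases "l < real n")
    case False
    \<comment> \<open>For \<open>n \<le> l\<close> all of \<open>V\<close> serves as
      \<open>S\<close>, and no vertex outside remains to be checked.\<close>
    then show ?thesis by (intro exI[of _ V]) (auto simp: n_def)
  next
    case True
    define T where "T = nat \<lceil>r\<rceil>"
    from ex_small_set_or_heavy_set[OF finV, of T "\<lambda>v. card (B v)" l]
    show ?thesis
    proof
      assume "\<exists>S\<subseteq>V. card S < T \<and> (\<forall>v\<in>V - S. real (card (B v)) + real (card S) \<le> l)"
      then obtain S where S: "S \<subseteq> V" "card S < T"
          "\<forall>v\<in>V - S. real (card (B v)) + real (card S) \<le> l" by blast
      have "real (card S) \<le> l + 1"
        using S(2) \<open>r \<ge> 0\<close> \<open>r \<le> l\<close> unfolding T_def by linarith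
      then show ?thesis using S by blast
    next
      assume "\<exists>X\<subseteq>V. card X = T \<and>
        real T * l - real T * (real T - 1) / 2 \<le> (\<Sum>x\<in>X. real (card (B x)))"
      then obtain X where X: "X \<subseteq> V" "card X = T"
        and heavy: "real T * l - real T * (real T - 1) / 2 \<le> (\<Sum>x\<in>X. real (card (B x)))" by blast
      have finX: "finite X" using X finV finite_subset by blast
      have "(\<Sum>y\<in>V. card {x \<in> X. y \<in> B x}) = (\<Sum>x\<in>X. card {y \<in> V. y \<in> B x})"
        using sum_multicount_gen[OF finV finX, of "\<lambda>y x. y \<in> B x"] by simp
      also have "\<dots> = (\<Sum>x\<in>X. card (B x))"
        using BV by (intro sum.cong refl arg_cong[where f = card]) auto
      finally have heavy': "real T * l - real T * (real T - 1) / 2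
          \<le> real (\<Sum>y\<in>V. card {x \<in> X. y \<in> B x})"
        using heavy by simp
      have "(s - 1) * (card X choose s) < (\<Sum>y\<in>V. card {x \<in> X. y \<in> B x} choose s)"
      proof (cases "s = 2")
        case True
        have "r = sqrt (real n)" using True by (simp add: r_def powr_half_sqrt)
        then show ?thesis
          using sum_choose_gt_two[OF finV, of n T "\<lambda>y. card {x \<in> X. y \<in> B x}"] n1 heavy' True X(2)
          by (simp add: n_def T_def l_def)
      next
        case False
        then have "3 \<le> s" using j by linarith
        then show ?thesis
          using sum_choose_gt_ge_three[OF finV, of n T s "\<lambda>y. card {x \<in> X. y \<in> B x}"]
            heavy' \<open>l < real n\<close> X(2)
          by (simp add: n_def T_def l_def r_def)
      qed
      then have "\<exists>X' Y'. X' \<subseteq> X \<and> card X' = s \<and> Y' \<subseteq> V \<and> card Y' = s \<and> (\<forall>x\<in>X'. Y' \<subseteq> B x)"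
        by (intro ex_biclique_if_many_incidences finX finV BV)
      then obtain X' Y' where XY: "X' \<subseteq> X" "card X' = s" "Y' \<subseteq> V" "card Y' = s"
          "\<forall>x\<in>X'. Y' \<subseteq> B x"
        by blast
      have XYB: "y \<in> B x" if "x \<in> X'" "y \<in> Y'" for x y
        using XY(5) that by blast
      have "\<exists>p. pc_cycle E c p \<and> length p = 2 * j"
      proof (rule pc_even_cycle_in_biclique)
        show "finite X'" "finite Y'" using XY finX finV finite_subset by blast+
        show "j \<le> card X'" "j \<le> card Y'" "2 \<le> j" using XY j by simp_all
        show "x \<noteq> y" if "x \<in> X'" "y \<in> Y'" for x y using Bneq XYB that by blast
        show "{x, y} \<in> E" if "x \<in> X'" "y \<in> Y'" for x y using BE XYB that by blast
        show "c {x, y} \<noteq> c {x, y'}" if "x \<in> X'" "y \<in> Y'" "y' \<in> Y'" "y \<noteq> y'" for x y y'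
          using Bx[OF XYB XYB] that by simp
        show "c {x, y} \<noteq> c {x', y}" if "x \<in> X'" "x' \<in> X'" "y \<in> Y'" "x \<noteq> x'" for x x' y
          using By[OF XYB XYB] that by simp
      qed
      then show ?thesis using no_cycle by blast
    qed
  qed
  then obtain S where S: "S \<subseteq> V" "real (card S) \<le> l + 1"
      "\<And>v. v \<in> V - S \<Longrightarrow> real (card (B v)) + real (card S) \<le> l" by blast
  obtain A where A: "\<forall>(u, v)\<in>A. {u, v} \<in> E"
      "\<forall>u v w. (u, v) \<in> A \<longrightarrow> (v, w) \<in> A \<longrightarrow> c {u, v} \<noteq> c {v, w}"
      "\<forall>v\<in>S. color_degree E c v + 1 \<le> card {w. (v, w) \<in> A} + card S"
      "\<forall>v\<in>V - S. color_degree E c v \<le> card {w. (v, w) \<in> A} + card (B v) + card S"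
    using BA[OF S(1)] by (elim exE conjE)
  have "l \<le> real s * real N powr (1 - 1 / real s)"
    unfolding l_def by (intro mult_left_mono rN) simp
  then have deg': "real_of_int g + l \<le> real (color_degree E c v)" if "v \<in> V" for v
    using deg[OF that] by linarith
  show thesis
  proof
    show "{u, v} \<in> E" if "(u, v) \<in> A" for u v using A(1) that by blast
    show "c {u, v} \<noteq> c {v, w}" if "(u, v) \<in> A" "(v, w) \<in> A" for u v w
      using A(2) that by simp
    show "g \<le> int (card {w. (v, w) \<in> A})" if v: "v \<in> V" for v
    proof (cases "v \<in> S")
      case True
      then have "color_degree E c v + 1 \<le> card {w. (v, w) \<in> A} + card S" using A(3) by simp
      then have "real (color_degree E c v) + 1 \<le> real (card {w. (v, w) \<in> A}) + real (card S)"
        by linarith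
      \<comment> \<open>The \<open>+ 1\<close> on the left of the degree bound cancels the
        \<open>+ 1\<close> allowed in the size of \<open>S\<close>.\<close>
      then show ?thesis using deg'[OF v] S(2) by linarith
    next
      case False
      then have "color_degree E c v \<le> card {w. (v, w) \<in> A} + card (B v) + card S"
        using A(4) v by simp
      then have "real (color_degree E c v)
          \<le> real (card {w. (v, w) \<in> A}) + real (card (B v)) + real (card S)"
        by linarith
      then show ?thesis using deg'[OF v] S(3)[of v] v False by auto
    qed
  qed
qed

section \<open>Directed cycles as cyclic vertex lists\<close>

lemma cas_imp_heads_tails:
  "pre_digraph.cas D u p v \<Longrightarrow> u # map (head D) p = map (tail D) p @ [v]"
  by (induction p arbitrary: u) (auto simp: pre_digraph.cas.simps)

lemma awalk_verts_eq: "pre_digraph.cas D u p v \<Longrightarrow> pre_digraph.awalk_verts D u p = u # map (head D) p"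
  by (induction p arbitrary: u) (auto simp: pre_digraph.cas.simps pre_digraph.awalk_verts.simps)

text \<open>The cycle predicate makes the heads distinct, whereas \<open>disjoint_dicycles\<close>
  speaks of tails. Along a closed walk the heads are the tails shifted cyclically by one
  place.\<close>

lemma cycle_heads_tails:
  assumes "pre_digraph.cycle D p"
  shows "p \<noteq> []" "set p \<subseteq> arcs D" "distinct (map (tail D) p)"
    "\<And>i. i < length p \<Longrightarrow> head D (p ! i) = tail D (p ! (Suc i mod length p))"
proof -
  obtain u where u: "set p \<subseteq> arcs D" "pre_digraph.cas D u p u"
      "distinct (tl (pre_digraph.awalk_verts D u p))" "p \<noteq> []"
    using assms by (auto simp: pre_digraph.cycle_def pre_digraph.awalk_def)
  then show "p \<noteq> []" "set p \<subseteq> arcs D" by blast+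
  have eq: "u # map (head D) p = map (tail D) p @ [u]"
    using cas_imp_heads_tails[OF u(2)] .
  have "distinct (map (head D) p)" using u(3) awalk_verts_eq[OF u(2)] by simp
  have nth: "head D (p ! i) = (map (tail D) p @ [u]) ! Suc i" if "i < length p" for i
    using arg_cong[OF eq, of "\<lambda>xs. xs ! Suc i"] that by simp
  have u0: "u = tail D (p ! 0)"
    using arg_cong[OF eq, of hd] u(4) by (cases p) auto
  show *: "head D (p ! i) = tail D (p ! (Suc i mod length p))" if "i < length p" for i
  proof (cases "Suc i = length p")
    case True
    then show ?thesis using nth[OF that] u0 by (simp add: nth_append)
  next
    case False
    then show ?thesis using nth[OF that] that by (simp add: nth_append)
  qed
  \<comment> \<open>Every head is a tail, so there are at least \<open>length p\<close> different
    tails and none is repeated.\<close>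
  have "set (map (head D) p) \<subseteq> set (map (tail D) p)"
  proof
    fix x assume "x \<in> set (map (head D) p)"
    then obtain i where "i < length p" "x = head D (p ! i)" by (auto simp: in_set_conv_nth)
    moreover from this have "Suc i mod length p < length p" by (auto intro: mod_less_divisor)
    ultimately show "x \<in> set (map (tail D) p)" using * by auto
  qed
  then have "length p \<le> card (set (map (tail D) p))"
    using distinct_card[OF \<open>distinct (map (head D) p)\<close>] card_mono
    by (metis List.finite_set length_map)
  then show "distinct (map (tail D) p)"
    by (metis card_distinct card_length le_antisym length_map)
qed

text \<open>Only lengths 1 and 2 need exclusion: a loop would be an edge with one vertex, and a pair
  of opposite arcs would be a turn between equal colors.\<close>

lemma pc_cycle_of_transitions:
  assumes G: "finite_simple_graph V E"
    and AE: "\<And>u v. (u, v) \<in> A \<Longrightarrow> {u, v} \<in> E"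
    and turn: "\<And>u v w. (u, v) \<in> A \<Longrightarrow> (v, w) \<in> A \<Longrightarrow> c {u, v} \<noteq> c {v, w}"
    and "q \<noteq> []" "distinct q"
    and step: "\<And>i. i < length q \<Longrightarrow> (q ! i, q ! (Suc i mod length q)) \<in> A"
  shows "pc_cycle E c q"
proof (rule pc_cycleI)
  have "length q \<noteq> 1"
  proof
    assume "length q = 1"
    then have "(q ! 0, q ! 0) \<in> A" using step[of 0] by simp
    then have "{q ! 0, q ! 0} \<in> E" by (rule AE)
    then have "card {q ! 0, q ! 0} = 2" using G unfolding finite_simple_graph_def by blast
    then show False by simp
  qed
  moreover have "length q \<noteq> 2"
  proof
    assume "length q = 2"
    then have "(q ! 0, q ! 1) \<in> A" "(q ! 1, q ! 0) \<in> A" using step[of 0] step[of 1] by simp_all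
    then show False using turn[of "q ! 0" "q ! 1" "q ! 0"] by (simp add: insert_commute)
  qed
  moreover have "length q \<noteq> 0" using \<open>q \<noteq> []\<close> by simp
  ultimately show "3 \<le> length q" by linarith
  show "{q ! i, q ! (Suc i mod length q)} \<in> E" if "i < length q" for i
    using AE step[OF that] by blast
  show "c {q ! i, q ! j} \<noteq> c {q ! j, q ! (Suc j mod length q)}"
    if "i < length q" "j = Suc i mod length q" for i j
  proof (rule turn)
    show "(q ! i, q ! j) \<in> A" using step that by simp
    have "j < length q" using that by (auto intro: mod_less_divisor)
    then show "(q ! j, q ! (Suc j mod length q)) \<in> A" by (rule step)
  qed
qed fact

text \<open>The forcing predicates quantify over digraphs on natural numbers, so \<open>A\<close> is
  relabelled along an injection \<open>f\<close>, and its directed cycles are pulled back without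
  changing lengths.\<close>

lemma ex_nat_digraph_of_transitions:
  fixes c :: "'a set \<Rightarrow> 'c" and g :: int
  assumes G: "finite_simple_graph V E" and "V \<noteq> {}"
    and AE: "\<And>u v. (u, v) \<in> A \<Longrightarrow> {u, v} \<in> E"
    and turn: "\<And>u v w. (u, v) \<in> A \<Longrightarrow> (v, w) \<in> A \<Longrightarrow> c {u, v} \<noteq> c {v, w}"
    and deg: "\<And>v. v \<in> V \<Longrightarrow> g \<le> int (card {w. (v, w) \<in> A})"
  obtains D :: nat_digraph where "digraph D" "verts D \<noteq> {}" "g \<le> int (min_out_degree D)"
    "\<And>P. disjoint_dicycles D P \<Longrightarrow> \<exists>Q. disjoint_pc_cycles E c Q \<and> card Q = card P \<and>
      (inj_on length P \<longrightarrow> inj_on length Q)"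
proof -
  have finV: "finite V" using G by (simp add: finite_simple_graph_def)
  have AV: "u \<in> V" "v \<in> V" "u \<noteq> v" if "(u, v) \<in> A" for u v
  proof -
    have "{u, v} \<subseteq> V" "card {u, v} = 2"
      using G AE[OF that] unfolding finite_simple_graph_def by blast+
    then show "u \<in> V" "v \<in> V" "u \<noteq> v" by auto
  qed
  obtain f :: "'a \<Rightarrow> nat" where f: "inj_on f V"
    using finite_imp_inj_to_nat_seg[OF finV] by blast
  define h where "h = inv_into V f"
  have hf: "h (f v) = v" if "v \<in> V" for v using that f by (simp add: h_def)
  have feq: "f u = f v \<longleftrightarrow> u = v" if "u \<in> V" "v \<in> V" for u v
    using that f by (simp add: inj_on_eq_iff)
  define D :: nat_digraph
    where "D = \<lparr>verts = f ` V, arcs = (\<lambda>(u, v). (f u, f v)) ` A, tail = fst, head = snd\<rparr>"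
  have "A \<subseteq> V \<times> V" using AV by auto
  then have finA: "finite A" using finV finite_subset by blast
  have "digraph D"
  proof
    show "tail D e \<in> verts D" "head D e \<in> verts D" "tail D e \<noteq> head D e" if "e \<in> arcs D" for e
      using that AV feq by (auto simp: D_def)
    show "finite (verts D)" "finite (arcs D)" using finV finA by (simp_all add: D_def)
    show "e1 = e2" if "arc_to_ends D e1 = arc_to_ends D e2" for e1 e2
      using that by (simp add: D_def arc_to_ends_def prod_eq_iff)
  qed
  moreover have "verts D \<noteq> {}" using \<open>V \<noteq> {}\<close> by (simp add: D_def)
  moreover have "g \<le> int (min_out_degree D)"
  proof -
    have out: "out_degree D (f v) = card {w. (v, w) \<in> A}" if v: "v \<in> V" for v
    proof -
      have "out_arcs D (f v) = (\<lambda>w. (f v, f w)) ` {w. (v, w) \<in> A}"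
      proof
        show "out_arcs D (f v) \<subseteq> (\<lambda>w. (f v, f w)) ` {w. (v, w) \<in> A}"
        proof
          fix e assume "e \<in> out_arcs D (f v)"
          then obtain u w where uw: "(u, w) \<in> A" "e = (f u, f w)" "f u = f v"
            by (auto simp: out_arcs_def D_def)
          moreover have "u = v" using uw feq[OF AV(1) v] by blast
          ultimately show "e \<in> (\<lambda>w. (f v, f w)) ` {w. (v, w) \<in> A}" by simp
        qed
      qed (auto simp: out_arcs_def D_def)
      moreover have "inj_on (\<lambda>w. (f v, f w)) {w. (v, w) \<in> A}"
        using AV feq by (auto simp: inj_on_def)
      ultimately show ?thesis by (simp add: out_degree_def card_image)
    qed
    have "min_out_degree D \<in> out_degree D ` verts D"
      unfolding min_out_degree_def using finV \<open>V \<noteq> {}\<close> by (intro Min_in) (auto simp: D_def)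
    then obtain v where "v \<in> V" "min_out_degree D = out_degree D (f v)" by (auto simp: D_def)
    then show ?thesis using out deg by simp
  qed
  moreover have "\<exists>Q. disjoint_pc_cycles E c Q \<and> card Q = card P \<and>
      (inj_on length P \<longrightarrow> inj_on length Q)" if P: "disjoint_dicycles D P" for P
  proof -
    define F where "F p = map (h \<circ> fst) p" for p :: "(nat \<times> nat) list"
    have tails: "fst ` set p \<subseteq> f ` V" if "p \<in> P" for p
    proof -
      have "pre_digraph.cycle D p" using P that by (simp add: disjoint_dicycles_def)
      then have "set p \<subseteq> arcs D" by (rule cycle_heads_tails(2))
      then show ?thesis using AV by (auto simp: D_def)
    qed
    have hinj: "inj_on h (f ` V)" using hf by (auto intro!: inj_onI)
    have cyc: "pc_cycle E c (F p)" if "p \<in> P" for p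
    proof (rule pc_cycle_of_transitions[where A = A])
      show "finite_simple_graph V E" by (rule G)
      show "{u, v} \<in> E" if "(u, v) \<in> A" for u v by (rule AE[OF that])
      show "c {u, v} \<noteq> c {v, w}" if "(u, v) \<in> A" "(v, w) \<in> A" for u v w
        by (rule turn[OF that])
      have "pre_digraph.cycle D p" using P that by (simp add: disjoint_dicycles_def)
      note p = cycle_heads_tails[OF this]
      show "F p \<noteq> []" using p(1) by (simp add: F_def)
      have "inj_on h (fst ` set p)" using hinj tails[OF that] inj_on_subset by blast
      then show "distinct (F p)"
        using p(3) by (simp add: F_def D_def distinct_map comp_inj_on)
      show "(F p ! i, F p ! (Suc i mod length (F p))) \<in> A" if "i < length (F p)" for i
      proof -
        have i: "i < length p" using that by (simp add: F_def)
        then have i': "Suc i mod length p < length p" by (auto intro: mod_less_divisor)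
        have "p ! i \<in> arcs D" using p(2) i by (auto intro: nth_mem)
        then obtain u v where uv: "(u, v) \<in> A" "p ! i = (f u, f v)" by (auto simp: D_def)
        moreover have "fst (p ! (Suc i mod length p)) = f v"
          using p(4)[OF i] uv by (simp add: D_def)
        ultimately show ?thesis using i i' hf AV by (simp add: F_def)
      qed
    qed
    have sets: "set (F p) = h ` fst ` set p" for p by (auto simp: F_def)
    have disj: "set (F p) \<inter> set (F p') = {}" if "p \<in> P" "p' \<in> P" "p \<noteq> p'" for p p'
    proof -
      have "fst ` set p \<inter> fst ` set p' = {}"
        using P that by (auto simp: disjoint_dicycles_def disjoint_family_on_def D_def)
      then show ?thesis
        unfolding sets inj_on_image_Int[OF hinj tails[OF that(1)] tails[OF that(2)], symmetric]
        by simp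
    qed
    \<comment> \<open>Different cycles have disjoint images, so a common image would have no
      vertices.\<close>
    have "inj_on F P"
    proof (rule inj_onI, rule ccontr)
      fix p p' assume "p \<in> P" "p' \<in> P" "F p = F p'" "p \<noteq> p'"
      then have "set (F p) = {}" using disj by fastforce
      then show False using cyc[OF \<open>p \<in> P\<close>] by (auto simp: pc_cycle_def)
    qed
    have "disjoint_pc_cycles E c (F ` P)"
      using P cyc disj by (auto simp: disjoint_pc_cycles_def disjoint_dicycles_def disjoint_family_on_def)
    moreover have "card (F ` P) = card P" using \<open>inj_on F P\<close> by (rule card_image)
    moreover have "inj_on length (F ` P)" if "inj_on length P"
      using that by (auto simp: inj_on_def F_def)
    ultimately show ?thesis by blast
  qed
  ultimately show thesis by (rule that)
qed

section \<open>Deleting vertices and packing cycles\<close>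

lemma finite_simple_graph_delete:
  "finite_simple_graph V E \<Longrightarrow> finite_simple_graph (V - R) {e \<in> E. e \<inter> R = {}}"
  by (auto simp: finite_simple_graph_def)

text \<open>A color lost at \<open>v\<close> sits on an edge from \<open>v\<close> into
  \<open>R\<close>, and each vertex of \<open>R\<close> ends at most one such edge.\<close>

lemma color_degree_delete:
  assumes G: "finite_simple_graph V E" and "finite R" and "v \<notin> R"
  shows "color_degree E c v \<le> color_degree {e \<in> E. e \<inter> R = {}} c v + card R"
proof -
  have "E \<subseteq> Pow V" "finite V" using G by (auto simp: finite_simple_graph_def)
  then have finE: "finite E" using finite_subset by blast
  have "c ` {e \<in> E. v \<in> e} \<subseteq> c ` {e \<in> {e \<in> E. e \<inter> R = {}}. v \<in> e} \<union> (\<lambda>w. c {v, w}) ` R"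
  proof
    fix x assume "x \<in> c ` {e \<in> E. v \<in> e}"
    then obtain e where e: "e \<in> E" "v \<in> e" "x = c e" by blast
    show "x \<in> c ` {e \<in> {e \<in> E. e \<inter> R = {}}. v \<in> e} \<union> (\<lambda>w. c {v, w}) ` R"
    proof (cases "e \<inter> R = {}")
      case False
      then obtain w where w: "w \<in> e" "w \<in> R" by blast
      have "card e = 2" using G e(1) by (simp add: finite_simple_graph_def)
      then have "e = {v, w}" using e(2) w \<open>v \<notin> R\<close> by (auto simp: card_2_iff)
      then show ?thesis using e(3) w(2) by blast
    qed (use e in blast)
  qed
  then have "color_degree E c v
      \<le> card (c ` {e \<in> {e \<in> E. e \<inter> R = {}}. v \<in> e} \<union> (\<lambda>w. c {v, w}) ` R)"
    unfolding color_degree_def using finE \<open>finite R\<close> by (intro card_mono) auto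
  also have "\<dots> \<le> card (c ` {e \<in> {e \<in> E. e \<inter> R = {}}. v \<in> e}) + card ((\<lambda>w. c {v, w}) ` R)"
    by (rule card_Un_le)
  also have "\<dots> \<le> color_degree {e \<in> E. e \<inter> R = {}} c v + card R"
    unfolding color_degree_def using \<open>finite R\<close> by (intro add_mono card_image_le) simp_all
  finally show ?thesis .
qed

text \<open>This is the deletion bound for \<open>R = V - {v}\<close>, after which no edge is
  left.\<close>

lemma color_degree_less_card:
  assumes G: "finite_simple_graph V E" and v: "v \<in> V"
  shows "color_degree E c v < card V"
proof -
  have finV: "finite V" using G by (simp add: finite_simple_graph_def)
  have "e \<inter> (V - {v}) \<noteq> {}" if "e \<in> E" for e
  proof
    assume "e \<inter> (V - {v}) = {}"
    then have "e \<subseteq> {v}" using G that by (auto simp: finite_simple_graph_def)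
    then have "card e \<le> card {v}" by (intro card_mono) auto
    then show False using G that by (auto simp: finite_simple_graph_def)
  qed
  then have empty: "{e \<in> E. e \<inter> (V - {v}) = {}} = {}" by blast
  have "color_degree {e \<in> E. e \<inter> (V - {v}) = {}} c v = 0"
    unfolding empty by (simp add: color_degree_def)
  moreover have "color_degree E c v \<le> color_degree {e \<in> E. e \<inter> (V - {v}) = {}} c v + card (V - {v})"
    using finV by (intro color_degree_delete[OF G]) auto
  ultimately show ?thesis using card_Suc_Diff1[OF finV v] by linarith
qed

lemma min_color_degree_le:
  assumes "finite_simple_graph V E" and "v \<in> V"
  shows "min_color_degree V E c \<le> color_degree E c v"
  using assms unfolding min_color_degree_def finite_simple_graph_def by (intro Min_le) auto

lemma pc_cycle_subset:
  assumes "finite_simple_graph V E" and "pc_cycle E c p"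
  shows "set p \<subseteq> V"
proof
  fix x assume "x \<in> set p"
  then obtain i where "i < length p" "x = p ! i" by (auto simp: in_set_conv_nth)
  then have "{x, p ! (Suc i mod length p)} \<in> E"
    using assms(2) by (auto simp: pc_cycle_def cycle_edges_def)
  then have "{x, p ! (Suc i mod length p)} \<subseteq> V"
    using assms(1) unfolding finite_simple_graph_def by blast
  then show "x \<in> V" by simp
qed

lemma pc_cycle_delete_iff:
  "pc_cycle {e \<in> E. e \<inter> R = {}} c p \<longleftrightarrow> pc_cycle E c p \<and> set p \<inter> R = {}"
proof -
  have "(\<forall>e\<in>cycle_edges p. e \<inter> R = {}) \<longleftrightarrow> set p \<inter> R = {}"
  proof
    assume avoid: "\<forall>e\<in>cycle_edges p. e \<inter> R = {}"
    show "set p \<inter> R = {}"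
    proof (rule ccontr)
      assume "set p \<inter> R \<noteq> {}"
      then obtain i where "i < length p" "p ! i \<in> R" by (auto simp: in_set_conv_nth)
      moreover from this have "{p ! i, p ! (Suc i mod length p)} \<inter> R = {}"
        using avoid by (auto simp: cycle_edges_def)
      ultimately show False by auto
    qed
  next
    assume avoid: "set p \<inter> R = {}"
    show "\<forall>e\<in>cycle_edges p. e \<inter> R = {}"
    proof
      fix e assume "e \<in> cycle_edges p"
      then obtain i where i: "i < length p" "e = {p ! i, p ! (Suc i mod length p)}"
        by (auto simp: cycle_edges_def)
      then have "Suc i mod length p < length p" by (auto intro: mod_less_divisor)
      then have "e \<subseteq> set p" using i by auto
      then show "e \<inter> R = {}" using avoid by blast
    qed
  qed
  then show ?thesis by (auto simp: pc_cycle_def)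
qed

text \<open>\<open>R\<close> will be the vertex set of a packing already found. The cycles obtained
  avoid \<open>R\<close>, so they can be added to that packing.\<close>

lemma ex_nat_digraph_after_deletion:
  fixes c :: "'a set \<Rightarrow> 'c" and g :: int
  assumes G: "finite_simple_graph V E" and "card V = n" "1 \<le> n" and R: "R \<subseteq> V" and "0 \<le> g"
    and j: "2 \<le> j" "j \<le> s"
    and no_cycle: "\<And>p. pc_cycle E c p \<Longrightarrow> set p \<inter> R = {} \<Longrightarrow> length p \<noteq> 2 * j"
    and deg: "real_of_int g + real (card R) + real s * real n powr (1 - 1 / real s)
      \<le> real (min_color_degree V E c)"
  obtains D :: nat_digraph where "digraph D" "verts D \<noteq> {}" "g \<le> int (min_out_degree D)"
    "\<And>P. disjoint_dicycles D P \<Longrightarrow> \<exists>Q. disjoint_pc_cycles E c Q \<and> card Q = card P \<and>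
      (inj_on length P \<longrightarrow> inj_on length Q) \<and> (\<forall>q\<in>Q. set q \<inter> R = {})"
proof -
  define E' where "E' = {e \<in> E. e \<inter> R = {}}"
  have finV: "finite V" using G by (simp add: finite_simple_graph_def)
  have finR: "finite R" using R finV finite_subset by blast
  have G': "finite_simple_graph (V - R) E'"
    unfolding E'_def by (rule finite_simple_graph_delete[OF G])
  \<comment> \<open>If \<open>R = V\<close>, then \<open>deg\<close> and \<open>0 \<le> g\<close>
    would force a color degree of at least \<open>card V\<close>.\<close>
  have ne: "V - R \<noteq> {}"
  proof
    assume "V - R = {}"
    then have "R = V" using R by blast
    obtain v where v: "v \<in> V" using assms(2,3) by fastforce
    have "min_color_degree V E c < card V"
      using min_color_degree_le[OF G v, of c] color_degree_less_card[OF G v, of c] by linarith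
    then have "real (min_color_degree V E c) < real (card R)" using \<open>R = V\<close> by simp
    moreover have "0 \<le> real s * real n powr (1 - 1 / real s)" by simp
    ultimately show False using deg \<open>0 \<le> g\<close> by linarith
  qed
  have "card (V - R) \<le> n" using assms(2) finV by (metis Diff_subset card_mono)
  show thesis
  proof (rule ex_transition_digraph[OF G' ne \<open>card (V - R) \<le> n\<close> j])
    show "length p \<noteq> 2 * j" if "pc_cycle E' c p" for p
      using that no_cycle unfolding E'_def pc_cycle_delete_iff by blast
    show "real_of_int g + real s * real n powr (1 - 1 / real s) \<le> real (color_degree E' c v)"
      if "v \<in> V - R" for v
    proof -
      have "min_color_degree V E c \<le> color_degree E' c v + card R"
        using min_color_degree_le[OF G, of v c] color_degree_delete[OF G finR, of v c] that
        unfolding E'_def by auto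
      then show ?thesis using deg by linarith
    qed
    fix A
    assume A: "\<And>u v. (u, v) \<in> A \<Longrightarrow> {u, v} \<in> E'"
      "\<And>u v w. (u, v) \<in> A \<Longrightarrow> (v, w) \<in> A \<Longrightarrow> c {u, v} \<noteq> c {v, w}"
      "\<And>v. v \<in> V - R \<Longrightarrow> g \<le> int (card {w. (v, w) \<in> A})"
    show thesis
    proof (rule ex_nat_digraph_of_transitions[OF G' ne, where A = A and c = c and g = g])
      show "{u, v} \<in> E'" if "(u, v) \<in> A" for u v by (rule A(1)[OF that])
      show "c {u, v} \<noteq> c {v, w}" if "(u, v) \<in> A" "(v, w) \<in> A" for u v w by (rule A(2)[OF that])
      show "g \<le> int (card {w. (v, w) \<in> A})" if "v \<in> V - R" for v by (rule A(3)[OF that])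
      fix D :: nat_digraph
      assume D: "digraph D" "verts D \<noteq> {}" "g \<le> int (min_out_degree D)"
        and cycles: "\<And>P. disjoint_dicycles D P \<Longrightarrow> \<exists>Q. disjoint_pc_cycles E' c Q \<and> card Q = card P \<and>
          (inj_on length P \<longrightarrow> inj_on length Q)"
      have E': "disjoint_pc_cycles E c Q \<and> (\<forall>q\<in>Q. set q \<inter> R = {})"
        if "disjoint_pc_cycles E' c Q" for Q
        using that unfolding disjoint_pc_cycles_def E'_def pc_cycle_delete_iff by blast
      show thesis
      proof (rule that[OF D])
        fix P assume "disjoint_dicycles D P"
        then obtain Q where Q: "disjoint_pc_cycles E' c Q" "card Q = card P"
            "inj_on length P \<longrightarrow> inj_on length Q"
          using cycles by meson
        show "\<exists>Q. disjoint_pc_cycles E c Q \<and> card Q = card P \<and>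
            (inj_on length P \<longrightarrow> inj_on length Q) \<and> (\<forall>q\<in>Q. set q \<inter> R = {})"
          by (intro exI[of _ Q] conjI Q E'[OF Q(1), THEN conjunct1] E'[OF Q(1), THEN conjunct2])
      qed
    qed
  qed
qed

section \<open>Packings of vertex-disjoint cycles\<close>

lemma disjoint_pc_cycles_Un:
  assumes P: "disjoint_pc_cycles E c P" and Q: "disjoint_pc_cycles E c Q"
    and disj: "\<forall>q\<in>Q. set q \<inter> \<Union>(set ` P) = {}"
  shows "disjoint_pc_cycles E c (P \<union> Q)" "card (P \<union> Q) = card P + card Q"
proof -
  show "disjoint_pc_cycles E c (P \<union> Q)"
    using assms unfolding disjoint_pc_cycles_def disjoint_family_on_def by blast
  have "P \<inter> Q = {}"
  proof (rule ccontr)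
    assume "P \<inter> Q \<noteq> {}"
    then obtain p where p: "p \<in> P" "p \<in> Q" by blast
    have "set p \<subseteq> \<Union>(set ` P)" using p(1) by blast
    moreover have "set p \<inter> \<Union>(set ` P) = {}" using p(2) disj by simp
    ultimately have "set p = {}" by (metis Int_absorb2)
    moreover have "pc_cycle E c p" using P p by (simp add: disjoint_pc_cycles_def)
    ultimately show False by (auto simp: pc_cycle_def)
  qed
  then show "card (P \<union> Q) = card P + card Q"
    using P Q by (simp add: disjoint_pc_cycles_def card_Un_disjoint)
qed

lemma card_vertices_disjoint_pc_cycles:
  assumes "disjoint_pc_cycles E c P"
  shows "card (\<Union>(set ` P)) = (\<Sum>p\<in>P. length p)"
proof -
  have "card (\<Union>(set ` P)) = (\<Sum>p\<in>P. card (set p))"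
    using assms unfolding disjoint_pc_cycles_def disjoint_family_on_def
    by (intro card_UN_disjoint) auto
  also have "\<dots> = (\<Sum>p\<in>P. length p)"
    using assms by (intro sum.cong) (auto simp: disjoint_pc_cycles_def pc_cycle_def distinct_card)
  finally show ?thesis .
qed

text \<open>Packing sizes are bounded by \<open>card V\<close>, so the \<open>Max\<close> in
  \<open>c4_number\<close> is attained. A 4-cycle avoiding the packing could be added to it.\<close>

lemma ex_maximum_c4_packing:
  assumes G: "finite_simple_graph V E"
  obtains P where "disjoint_pc_cycles E c P" "\<forall>p\<in>P. length p = 4" "card P = c4_number E c"
    "\<And>p. pc_cycle E c p \<Longrightarrow> set p \<inter> \<Union>(set ` P) = {} \<Longrightarrow> length p \<noteq> 4"
proof -
  define K where "K = {card P | P. disjoint_pc_cycles E c P \<and> (\<forall>p\<in>P. length p = 4)}"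
  have finV: "finite V" using G by (simp add: finite_simple_graph_def)
  have "card P \<le> card V" if P: "disjoint_pc_cycles E c P" "\<forall>p\<in>P. length p = 4" for P
  proof -
    have "\<Union>(set ` P) \<subseteq> V" using P(1) pc_cycle_subset[OF G, of c] by (auto simp: disjoint_pc_cycles_def)
    then have "(\<Sum>p\<in>P. length p) \<le> card V"
      using card_mono[OF finV] card_vertices_disjoint_pc_cycles[OF P(1)] by metis
    then show ?thesis using P(2) by simp
  qed
  then have "K \<subseteq> {..card V}" by (auto simp: K_def)
  then have finK: "finite K" using finite_subset by blast
  have "card ({} :: 'a list set) \<in> K"
    unfolding K_def by (intro CollectI exI[of _ "{}"]) (simp add: disjoint_pc_cycles_def disjoint_family_on_def)
  then have "K \<noteq> {}" by blast
  then have "c4_number E c \<in> K" unfolding c4_number_def K_def[symmetric] by (intro Max_in finK)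
  then obtain P where P: "disjoint_pc_cycles E c P" "\<forall>p\<in>P. length p = 4" "card P = c4_number E c"
    by (auto simp: K_def)
  moreover have "length p \<noteq> 4" if p: "pc_cycle E c p" "set p \<inter> \<Union>(set ` P) = {}" for p
  proof
    assume "length p = 4"
    have "disjoint_pc_cycles E c {p}" using p(1) by (simp add: disjoint_pc_cycles_def disjoint_family_on_def)
    note Un = disjoint_pc_cycles_Un[OF P(1) this]
    have "disjoint_pc_cycles E c (P \<union> {p})" "card (P \<union> {p}) = card P + 1"
      using Un p(2) by simp_all
    then have "card P + 1 \<in> K"
      unfolding K_def using P(2) \<open>length p = 4\<close> by (intro CollectI exI[of _ "P \<union> {p}"]) auto
    then have "card P + 1 \<le> c4_number E c"
      unfolding c4_number_def K_def[symmetric] by (intro Max_ge finK)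
    then show False using P(3) by simp
  qed
  ultimately show thesis by (rule that)
qed

section \<open>From forced directed cycles to the two degree conditions\<close>

text \<open>With at least \<open>k\<close> packed 4-cycles, any \<open>k\<close> of them suffice;
  hence the conditional hypotheses. Otherwise the packing is deleted at a cost of 4 per cycle, and
  the case \<open>j = s = 2\<close> costs \<open>2 * sqrt n\<close>.\<close>

lemma disjoint_pc_cycles_if_forces_dicycles:
  assumes G: "finite_simple_graph V E" and n: "card V = n" "1 \<le> n"
    and f: "c4_number E c < k \<Longrightarrow> forces_dicycles (int d) (k - c4_number E c)"
    and deg: "c4_number E c < k \<Longrightarrow>
      real d + 4 * real (c4_number E c) + 2 * sqrt (real n) \<le> real (min_color_degree V E c)"
  shows "\<exists>P. disjoint_pc_cycles E c P \<and> card P = k"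
proof -
  obtain P where P: "disjoint_pc_cycles E c P" "\<forall>p\<in>P. length p = 4" "card P = c4_number E c"
      and max: "\<And>p. pc_cycle E c p \<Longrightarrow> set p \<inter> \<Union>(set ` P) = {} \<Longrightarrow> length p \<noteq> 4"
    using ex_maximum_c4_packing[OF G] by metis
  show ?thesis
  proof (cases "c4_number E c < k")
    case False
    then obtain P' where "P' \<subseteq> P" "card P' = k" using P(3) obtain_subset_with_card_n by (metis not_less)
    moreover from this have "disjoint_pc_cycles E c P'"
      using P(1) finite_subset unfolding disjoint_pc_cycles_def disjoint_family_on_def by blast
    ultimately show ?thesis by blast
  next
    case True
    have "\<Union>(set ` P) \<subseteq> V" using P(1) pc_cycle_subset[OF G, of c] by (auto simp: disjoint_pc_cycles_def)
    moreover have "card (\<Union>(set ` P)) = 4 * c4_number E c"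
      using card_vertices_disjoint_pc_cycles[OF P(1)] P(2,3) by simp
    then have "real_of_int (int d) + real (card (\<Union>(set ` P))) + real 2 * real n powr (1 - 1 / real 2)
        \<le> real (min_color_degree V E c)"
      using deg[OF True] by (simp add: powr_half_sqrt)
    ultimately obtain D :: nat_digraph where D: "digraph D" "verts D \<noteq> {}" "int d \<le> int (min_out_degree D)"
      and cycles: "\<And>P'. disjoint_dicycles D P' \<Longrightarrow> \<exists>Q. disjoint_pc_cycles E c Q \<and> card Q = card P' \<and>
        (inj_on length P' \<longrightarrow> inj_on length Q) \<and> (\<forall>q\<in>Q. set q \<inter> \<Union>(set ` P) = {})"
      using max by (elim ex_nat_digraph_after_deletion[OF G n, where j = 2 and c = c, rotated -1]) auto
    obtain P' where "disjoint_dicycles D P'" "card P' = k - c4_number E c"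
      using f[OF True] D unfolding forces_dicycles_def by blast
    then obtain Q where Q: "disjoint_pc_cycles E c Q" "card Q = k - c4_number E c"
        "\<forall>q\<in>Q. set q \<inter> \<Union>(set ` P) = {}"
      using cycles by metis
    show ?thesis
      using disjoint_pc_cycles_Un[OF P(1) Q(1,3)] P(3) Q(2) True by (intro exI[of _ "P \<union> Q"]) simp
  qed
qed

text \<open>A single vertex without arcs has out-degree 0 and no directed cycle, so it refutes every
  negative \<open>g\<close>.\<close>

lemma forces_dicycles_diff_lengths_nonneg:
  assumes "forces_dicycles_diff_lengths g k" "1 \<le> k"
  shows "0 \<le> g"
proof (rule ccontr)
  assume "\<not> 0 \<le> g"
  define D :: nat_digraph where "D = \<lparr>verts = {0}, arcs = {}, tail = fst, head = snd\<rparr>"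
  have "digraph D" by unfold_locales (auto simp: D_def)
  moreover have "verts D \<noteq> {}" by (simp add: D_def)
  moreover have "g \<le> int (min_out_degree D)" using \<open>\<not> 0 \<le> g\<close> by simp
  ultimately obtain P where "disjoint_dicycles D P" "card P = k"
    using assms(1) unfolding forces_dicycles_diff_lengths_def by blast
  moreover from this obtain p where "p \<in> P" using assms(2) by fastforce
  ultimately have "pre_digraph.cycle D p" by (simp add: disjoint_dicycles_def)
  then show False using cycle_heads_tails(1,2)[of D p] by (simp add: D_def)
qed

text \<open>Unless the digraph supplies the cycles at some stage, disjoint cycles of lengths 4, 6,
  ... can be removed one after another; after \<open>k\<close> rounds they are themselves the
  required cycles.\<close>

lemma disjoint_pc_cycles_if_forces_dicycles_diff_lengths:
  assumes G: "finite_simple_graph V E" and n: "card V = n" "1 \<le> n" and k: "1 \<le> k"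
    and f: "forces_dicycles_diff_lengths g k"
    and deg: "real_of_int g + (real k + 1) * (real k + real n powr (1 - 1 / (real k + 1)))
      \<le> real (min_color_degree V E c)"
  shows "\<exists>P. disjoint_pc_cycles E c P \<and> card P = k \<and> inj_on length P"
proof (rule ccontr)
  assume none: "\<not> ?thesis"
  \<comment> \<open>The total \<open>i * (i + 3)\<close> is
    \<open>4 + 6 + ... + (2 * i + 2)\<close>. The bound on the lengths makes the next length
    \<open>2 * i + 4\<close> new.\<close>
  have "\<exists>P. disjoint_pc_cycles E c P \<and> card P = i \<and> inj_on length P \<and>
      (\<forall>p\<in>P. length p \<le> 2 * i + 2) \<and> (\<Sum>p\<in>P. length p) = i * (i + 3)" if "i \<le> k" for i
    using that
  proof (induction i)
    case 0
    show ?case by (intro exI[of _ "{}"]) (simp add: disjoint_pc_cycles_def disjoint_family_on_def)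
  next
    case (Suc i)
    then obtain P where P: "disjoint_pc_cycles E c P" "card P = i" "inj_on length P"
        "\<forall>p\<in>P. length p \<le> 2 * i + 2" "(\<Sum>p\<in>P. length p) = i * (i + 3)" by auto
    have "\<Union>(set ` P) \<subseteq> V" using P(1) pc_cycle_subset[OF G, of c] by (auto simp: disjoint_pc_cycles_def)
    have "\<exists>p. pc_cycle E c p \<and> set p \<inter> \<Union>(set ` P) = {} \<and> length p = 2 * (i + 2)"
    proof (rule ccontr)
      assume no: "\<not> ?thesis"
      have "i * (i + 3) \<le> k * (k + 1)"
      proof -
        have "i * (i + 3) \<le> i * (i + 3) + 2" by simp
        also have "\<dots> = (i + 1) * (i + 2)" by (simp add: algebra_simps)
        also have "\<dots> \<le> k * (k + 1)" using Suc.prems by (intro mult_le_mono) simp_all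
        finally show ?thesis .
      qed
      then have "real (card (\<Union>(set ` P))) \<le> real (k * (k + 1))"
        using card_vertices_disjoint_pc_cycles[OF P(1)] P(5) by (simp only: of_nat_le_iff)
      \<comment> \<open>The part \<open>(k + 1) * k\<close> of the assumed degree pays for the
        deleted vertices, the rest for the case \<open>s = k + 1\<close>.\<close>
      then have deg': "real_of_int g + real (card (\<Union>(set ` P)))
          + real (k + 1) * real n powr (1 - 1 / real (k + 1)) \<le> real (min_color_degree V E c)"
        using deg by (simp add: algebra_simps)
      show False
      proof (rule ex_nat_digraph_after_deletion[OF G n \<open>\<Union>(set ` P) \<subseteq> V\<close>
            forces_dicycles_diff_lengths_nonneg[OF f k] _ _ _ deg', of "i + 2"])
        show "2 \<le> i + 2" "i + 2 \<le> k + 1" using Suc.prems by simp_all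
        show "length p \<noteq> 2 * (i + 2)" if "pc_cycle E c p" "set p \<inter> \<Union>(set ` P) = {}" for p
          using no that by blast
        fix D :: nat_digraph
        assume D: "digraph D" "verts D \<noteq> {}" "g \<le> int (min_out_degree D)"
          and cycles: "\<And>P'. disjoint_dicycles D P' \<Longrightarrow> \<exists>Q. disjoint_pc_cycles E c Q \<and>
            card Q = card P' \<and> (inj_on length P' \<longrightarrow> inj_on length Q) \<and>
            (\<forall>q\<in>Q. set q \<inter> \<Union>(set ` P) = {})"
        obtain P' where P': "disjoint_dicycles D P'" "card P' = k" "inj_on length P'"
          using f D unfolding forces_dicycles_diff_lengths_def by blast
        show False using cycles[OF P'(1)] P'(2,3) none by auto
      qed
    qed
    then obtain p where p: "pc_cycle E c p" "set p \<inter> \<Union>(set ` P) = {}" "length p = 2 * (i + 2)"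
      by blast
    have "disjoint_pc_cycles E c {p}" using p(1) by (simp add: disjoint_pc_cycles_def disjoint_family_on_def)
    note Un = disjoint_pc_cycles_Un[OF P(1) this]
    have new: "p \<notin> P" using P(4) p(3) by fastforce
    have fin: "finite P" using P(1) by (simp add: disjoint_pc_cycles_def)
    show ?case
    proof (intro exI[of _ "P \<union> {p}"] conjI)
      show "disjoint_pc_cycles E c (P \<union> {p})" "card (P \<union> {p}) = Suc i"
        using Un p(2) P(2) by simp_all
      show "inj_on length (P \<union> {p})" using P(3,4) p(3) by (fastforce simp: inj_on_def)
      show "\<forall>q\<in>P \<union> {p}. length q \<le> 2 * Suc i + 2" using P(4) p(3) by fastforce
      show "(\<Sum>q\<in>P \<union> {p}. length q) = Suc i * (Suc i + 3)"
        using P(5) p(3) new fin by (simp add: algebra_simps)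
    qed
  qed
  then show False using none by blast
qed

text \<open>In \<open>enat\<close> the infimum of the empty set is infinite; a finite value
  therefore means that the set is nonempty and attains its infimum.\<close>

lemma forces_dicycles_bt_f:
  assumes "bt_f (int j) = enat d" "1 \<le> j"
  shows "forces_dicycles (int d) j"
proof -
  define F where "F = {enat d | d. forces_dicycles (int d) j}"
  have Inf: "Inf F = enat d" using assms by (simp add: bt_f_def F_def)
  then have "F \<noteq> {}" by (auto simp: Inf_enat_def)
  then have "Inf F \<in> F" unfolding Inf_enat_def by (auto intro: LeastI)
  then show ?thesis using Inf by (auto simp: F_def)
qed

theorem theorem4p1:
  fixes V :: "'a set" and E :: "'a set set" and c :: "'a set \<Rightarrow> 'c" and n k :: nat
  assumes "finite_simple_graph V E" and "card V = n" and "n \<ge> 1" and "k \<ge> 1"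
  shows
    "(ereal (real (min_color_degree V E c))
        \<ge> ereal_of_enat (bt_f (int k - int (c4_number E c)))
           + ereal (4 * real (c4_number E c) + 2 * sqrt (real n) + 1)
      \<longrightarrow> (\<exists>P. disjoint_pc_cycles E c P \<and> card P = k))
   \<and> ((\<forall>j::nat. j \<ge> 1 \<longrightarrow> bt_f (int j) = enat (2 * j - 1))
      \<longrightarrow> real (min_color_degree V E c) \<ge> 4 * real k + 2 * sqrt (real n) + 1
      \<longrightarrow> (\<exists>P. disjoint_pc_cycles E c P \<and> card P = k))
   \<and> (\<forall>g::int. forces_dicycles_diff_lengths g k
      \<longrightarrow> real (min_color_degree V E c)
           \<ge> real_of_int g + (real k + 1) * (real k + real n powr (1 - 1 / (real k + 1)))
      \<longrightarrow> (\<exists>P. disjoint_pc_cycles E c P \<and> card P = k \<and> inj_on length P))"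
proof (intro conjI impI allI)
  assume deg: "ereal (real (min_color_degree V E c))
        \<ge> ereal_of_enat (bt_f (int k - int (c4_number E c)))
           + ereal (4 * real (c4_number E c) + 2 * sqrt (real n) + 1)"
  \<comment> \<open>An infinite \<open>bt_f\<close> would make the right-hand side infinite, above
    the finite color degree.\<close>
  then obtain d where d: "bt_f (int k - int (c4_number E c)) = enat d"
    by (cases "bt_f (int k - int (c4_number E c))") auto
  show "\<exists>P. disjoint_pc_cycles E c P \<and> card P = k"
  proof (rule disjoint_pc_cycles_if_forces_dicycles[OF assms(1-3), of c k d])
    assume less: "c4_number E c < k"
    then have "bt_f (int (k - c4_number E c)) = enat d" using d by (simp add: of_nat_diff)
    then show "forces_dicycles (int d) (k - c4_number E c)"
      using less by (intro forces_dicycles_bt_f) auto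
    show "real d + 4 * real (c4_number E c) + 2 * sqrt (real n) \<le> real (min_color_degree V E c)"
      using deg d by simp
  qed
next
  assume f: "\<forall>j::nat. j \<ge> 1 \<longrightarrow> bt_f (int j) = enat (2 * j - 1)"
    and deg: "real (min_color_degree V E c) \<ge> 4 * real k + 2 * sqrt (real n) + 1"
  show "\<exists>P. disjoint_pc_cycles E c P \<and> card P = k"
  proof (rule disjoint_pc_cycles_if_forces_dicycles[OF assms(1-3), of c k "2 * (k - c4_number E c) - 1"])
    assume less: "c4_number E c < k"
    then have "bt_f (int (k - c4_number E c)) = enat (2 * (k - c4_number E c) - 1)"
      by (intro f[rule_format]) simp
    then show "forces_dicycles (int (2 * (k - c4_number E c) - 1)) (k - c4_number E c)"
      by (rule forces_dicycles_bt_f) (use less in simp)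
    \<comment> \<open>For \<open>m = c4_number E c\<close> the left-hand side is
      \<open>2 * k + 2 * m - 1\<close>, and \<open>m < k\<close>.\<close>
    have "real (2 * (k - c4_number E c) - 1) + 4 * real (c4_number E c) \<le> 4 * real k"
      using less by linarith
    then show "real (2 * (k - c4_number E c) - 1) + 4 * real (c4_number E c) + 2 * sqrt (real n)
        \<le> real (min_color_degree V E c)"
      using deg by linarith
  qed
next
  fix g :: int
  assume "forces_dicycles_diff_lengths g k"
    and "real (min_color_degree V E c)
      \<ge> real_of_int g + (real k + 1) * (real k + real n powr (1 - 1 / (real k + 1)))"
  then show "\<exists>P. disjoint_pc_cycles E c P \<and> card P = k \<and> inj_on length P"
    by (intro disjoint_pc_cycles_if_forces_dicycles_diff_lengths[OF assms])
qed

end
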